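(* Let $\Gamma$ be a general chain of $g$ loops, let $d$ be an integer, $r\ge 0$ an integer, $k=r+1$, $\bar k=g-d+r$, and assume $\bar k\ge 0$. Put $\rho=g-k\bar k$. Then the Brill-Noether locus of degree $d$ and rank $r$ on $\Gamma$ is a union of $$\binom{g}{\rho}\,c(k,\bar k)$$ products of $\rho$ loops. These products correspond to the fillings of the $k\times\bar k$ rectangular Young diagram ($k$ columns, $\bar k$ rows) by $g-\rho=k\bar k$ distinct numbers from the set $\{1,2,\dots,g\}$, strictly increasing along rows and down columns ($c(k,\bar k)$ fillings for each choice of the $k\bar k$ numbers). The loops appearing in the product corresponding to a tableau are the loops $\Gamma_i$ whose indices $i$ do not appear in that tableau.
   Context: A tropical curve is a metric graph $\Gamma$. Divisors are elements of the free abelian group on the points of $\Gamma$. A function on $\Gamma$ is a continuous piecewise linear function with integral slopes; its divisor has at each point weight equal to the sum of the incoming slopes along the edges at that point. Two divisors are equivalent ($\equiv$) if they differ by the divisor of such a function; $\mathrm{Pic}^d(\Gamma)$ is the set of equivalence classes of divisors of degree $d$. A divisor $D$ has rank at least $r$ if for every effective divisor $D'$ of degree $r$, $D-D'$ is equivalent to an effective divisor. The Brill-Noether locus of degree $d$ and rank $r$ is the set of classes in $\mathrm{Pic}^d(\Gamma)$ of divisors of rank at least $r$. Chain of $g$ loops: for $i=1,\dots,g$ take segments $\mathscr L_i,\mathscr M_i$ of real lengths $l_i,m_i>0$ and identify the two ends of $\mathscr L_i$ with the two ends of $\mathscr M_i$; this gives a loop $\Gamma_i$ with two marked points $Q_{i-1},Q_i$.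 Glue consecutive loops $\Gamma_i,\Gamma_{i+1}$ at the point $Q_i$ ($i=1,\dots,g-1$); thus $Q_0\in\Gamma_1$ and $Q_g\in\Gamma_g$ are the remaining marked points. The chain is general if the lengths are generic, in the sense that no quotient $l_i/m_i$ equals the quotient of two positive integers less than $2g-2$. By a product of loops $\Gamma_i$, $i\in S$, in $\mathrm{Pic}^d(\Gamma)$ is meant a subset of the form $\{[\,E+\sum_{i\in S}x_i\,] : x_i\in\Gamma_i \text{ for } i\in S\}$ with $E$ a fixed divisor. $c(k,\bar k)$ denotes the number of standard Young tableaux of rectangular shape with $k$ columns and $\bar k$ rows (equal to $1$ if $\bar k=0$); $\binom{g}{\rho}=0$ if $\rho<0$ (the locus is then empty). *)

theory Defs
  imports "HOL-Analysis.Analysis" "HOL-Algebra.Free_Abelian_Groups"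
begin

section \<open>Metric graphs\<close>

text \<open>
  The fields \<open>source\<close> and \<open>target\<close> merely choose a parametrization of each edge
  \<open>e\<close> by the interval from \<open>0\<close> to \<open>len G e\<close>.
\<close>

record ('v, 'e) metric_graph =
  verts :: "'v set"
  edges :: "'e set"
  source :: "'e \<Rightarrow> 'v"
  target :: "'e \<Rightarrow> 'v"
  len :: "'e \<Rightarrow> real"

definition wf_metric_graph :: "('v, 'e) metric_graph \<Rightarrow> bool" where
  "wf_metric_graph G \<longleftrightarrow> finite (verts G) \<and> verts G \<noteq> {} \<and> finite (edges G) \<and>
     (\<forall>e\<in>edges G. source G e \<in> verts G \<and> target G e \<in> verts G \<and> 0 < len G e)"

text \<open>
  The quotient of the disjoint union of the segments by the identification of their ends is
  represented as the disjoint union of the vertices and of the open edges; \<open>edge_point G e\<close> is the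
  quotient map on the closed segment belonging to \<open>e\<close>.
\<close>

datatype ('v, 'e) gpoint = Vertex 'v | Inner 'e real

definition points :: "('v, 'e) metric_graph \<Rightarrow> ('v, 'e) gpoint set" where
  "points G = Vertex ` verts G \<union> {Inner e t | e t. e \<in> edges G \<and> 0 < t \<and> t < len G e}"

definition edge_point :: "('v, 'e) metric_graph \<Rightarrow> 'e \<Rightarrow> real \<Rightarrow> ('v, 'e) gpoint" where
  "edge_point G e t =
     (if t \<le> 0 then Vertex (source G e)
      else if len G e \<le> t then Vertex (target G e)
      else Inner e t)"


section \<open>Divisors and piecewise linear functions\<close>

type_synonym ('v, 'e) divisor = "('v, 'e) gpoint \<Rightarrow>\<^sub>0 int"

definition divisors :: "('v, 'e) metric_graph \<Rightarrow> ('v, 'e) divisor set" where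
  "divisors G = carrier (free_Abelian_group (points G))"

definition degree :: "('v, 'e) divisor \<Rightarrow> int" where
  "degree D = (\<Sum>p\<in>Poly_Mapping.keys D. Poly_Mapping.lookup D p)"

definition effective :: "('v, 'e) divisor \<Rightarrow> bool" where
  "effective D \<longleftrightarrow> (\<forall>p. 0 \<le> Poly_Mapping.lookup D p)"

definition integral_pl_on :: "real \<Rightarrow> (real \<Rightarrow> real) \<Rightarrow> bool" where
  "integral_pl_on a h \<longleftrightarrow> continuous_on {0..a} h \<and>
     (\<exists>B. finite B \<and>
        (\<forall>s t. 0 \<le> s \<and> s < t \<and> t \<le> a \<and> {s<..<t} \<inter> B = {} \<longrightarrow>
           (\<exists>(n::int) c. \<forall>x\<in>{s<..<t}. h x = c + of_int n * x)))"

definition graph_function :: "('v, 'e) metric_graph \<Rightarrow> (('v, 'e) gpoint \<Rightarrow> real) \<Rightarrow> bool" where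
  "graph_function G f \<longleftrightarrow> (\<forall>e\<in>edges G. integral_pl_on (len G e) (\<lambda>t. f (edge_point G e t)))"

definition right_slope :: "(real \<Rightarrow> real) \<Rightarrow> real \<Rightarrow> int" where
  "right_slope h t = (THE n. \<forall>\<^sub>F x in at_right t. h x = h t + of_int n * (x - t))"

definition left_slope :: "(real \<Rightarrow> real) \<Rightarrow> real \<Rightarrow> int" where
  "left_slope h t = (THE n. \<forall>\<^sub>F x in at_left t. h x = h t + of_int n * (x - t))"

text \<open>
  The sum of the incoming slopes at a point.  An edge running into the point contributes the left
  slope at its end, an edge running out of it contributes minus the right slope at its start; an
  edge with both ends at the same vertex contributes twice, once for each end.
\<close>

fun incoming_slopes ::
  "('v, 'e) metric_graph \<Rightarrow> (('v, 'e) gpoint \<Rightarrow> real) \<Rightarrow> ('v, 'e) gpoint \<Rightarrow> int" where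
  "incoming_slopes G f (Vertex v) =
     (\<Sum>e\<in>{e \<in> edges G. target G e = v}. left_slope (\<lambda>s. f (edge_point G e s)) (len G e)) +
     (\<Sum>e\<in>{e \<in> edges G. source G e = v}. - right_slope (\<lambda>s. f (edge_point G e s)) 0)"
| "incoming_slopes G f (Inner e t) =
     left_slope (\<lambda>s. f (edge_point G e s)) t - right_slope (\<lambda>s. f (edge_point G e s)) t"

definition is_divisor_of ::
  "('v, 'e) metric_graph \<Rightarrow> ('v, 'e) divisor \<Rightarrow> (('v, 'e) gpoint \<Rightarrow> real) \<Rightarrow> bool" where
  "is_divisor_of G D f \<longleftrightarrow> D \<in> divisors G \<and>
     (\<forall>p\<in>points G. Poly_Mapping.lookup D p = incoming_slopes G f p)"

definition div_equiv :: "('v, 'e) metric_graph \<Rightarrow> (('v, 'e) divisor \<times> ('v, 'e) divisor) set" where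
  "div_equiv G = {(D, D'). D \<in> divisors G \<and> D' \<in> divisors G \<and>
     (\<exists>f. graph_function G f \<and> is_divisor_of G (D - D') f)}"

definition div_class :: "('v, 'e) metric_graph \<Rightarrow> ('v, 'e) divisor \<Rightarrow> ('v, 'e) divisor set" where
  "div_class G D = div_equiv G `` {D}"

definition Pic :: "('v, 'e) metric_graph \<Rightarrow> int \<Rightarrow> ('v, 'e) divisor set set" where
  "Pic G d = {D \<in> divisors G. degree D = d} // div_equiv G"

definition rank_at_least :: "('v, 'e) metric_graph \<Rightarrow> ('v, 'e) divisor \<Rightarrow> nat \<Rightarrow> bool" where
  "rank_at_least G D r \<longleftrightarrow>
     (\<forall>D'\<in>divisors G. effective D' \<and> degree D' = int r \<longrightarrow>
        (\<exists>F\<in>divisors G. effective F \<and> (D - D', F) \<in> div_equiv G))"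

definition brill_noether_locus ::
  "('v, 'e) metric_graph \<Rightarrow> int \<Rightarrow> nat \<Rightarrow> ('v, 'e) divisor set set" where
  "brill_noether_locus G d r =
     {C \<in> Pic G d. \<exists>D\<in>divisors G. C = div_class G D \<and> rank_at_least G D r}"


section \<open>Chains of loops\<close>

text \<open>
  The vertex \<open>i\<close> is the marked point \<open>Q\<^sub>i\<close>; \<open>Seg_L i\<close> and \<open>Seg_M i\<close> are the two segments, of
  lengths \<open>l i\<close> and \<open>m i\<close>, forming the \<open>i\<close>-th loop.
\<close>

datatype chain_edge = Seg_L nat | Seg_M nat

fun edge_index :: "chain_edge \<Rightarrow> nat" where
  "edge_index (Seg_L i) = i"
| "edge_index (Seg_M i) = i"

definition loop_chain ::
  "nat \<Rightarrow> (nat \<Rightarrow> real) \<Rightarrow> (nat \<Rightarrow> real) \<Rightarrow> (nat, chain_edge) metric_graph" where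
  "loop_chain g l m =
     \<lparr>verts = {0..g},
      edges = Seg_L ` {1..g} \<union> Seg_M ` {1..g},
      source = (\<lambda>e. edge_index e - 1),
      target = edge_index,
      len = (\<lambda>e. case e of Seg_L i \<Rightarrow> l i | Seg_M i \<Rightarrow> m i)\<rparr>"

lemma wf_loop_chain:
  assumes "\<And>i. i \<in> {1..g} \<Longrightarrow> 0 < l i" and "\<And>i. i \<in> {1..g} \<Longrightarrow> 0 < m i"
  shows "wf_metric_graph (loop_chain g l m)"
  using assms by (auto simp: wf_metric_graph_def loop_chain_def)

definition chain_loop ::
  "nat \<Rightarrow> (nat \<Rightarrow> real) \<Rightarrow> (nat \<Rightarrow> real) \<Rightarrow> nat \<Rightarrow> (nat, chain_edge) gpoint set" where
  "chain_loop g l m i =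
     edge_point (loop_chain g l m) (Seg_L i) ` {0..l i} \<union>
     edge_point (loop_chain g l m) (Seg_M i) ` {0..m i}"

definition general_chain :: "nat \<Rightarrow> (nat \<Rightarrow> real) \<Rightarrow> (nat \<Rightarrow> real) \<Rightarrow> bool" where
  "general_chain g l m \<longleftrightarrow>
     (\<forall>i\<in>{1..g}. 0 < l i \<and> 0 < m i) \<and>
     (\<forall>i\<in>{1..g}. \<forall>p q :: int. 0 < p \<and> p < 2 * int g - 2 \<and> 0 < q \<and> q < 2 * int g - 2 \<longrightarrow>
        l i / m i \<noteq> of_int p / of_int q)"

definition is_loop_product ::
  "nat \<Rightarrow> (nat \<Rightarrow> real) \<Rightarrow> (nat \<Rightarrow> real) \<Rightarrow> int \<Rightarrow> nat set \<Rightarrow>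
     (nat, chain_edge) divisor set set \<Rightarrow> bool" where
  "is_loop_product g l m d S P \<longleftrightarrow>
     S \<subseteq> {1..g} \<and> P \<subseteq> Pic (loop_chain g l m) d \<and>
     (\<exists>E\<in>divisors (loop_chain g l m).
        P = {div_class (loop_chain g l m) (E + (\<Sum>i\<in>S. frag_of (x i))) | x.
               \<forall>i\<in>S. x i \<in> chain_loop g l m i})"


section \<open>Rectangular tableaux\<close>

text \<open>A cell is a pair (row, column); the rectangle has \<open>k\<close> columns and \<open>h\<close> rows.\<close>

definition cells :: "nat \<Rightarrow> nat \<Rightarrow> (nat \<times> nat) set" where
  "cells k h = {1..h} \<times> {1..k}"

definition fillings :: "nat \<Rightarrow> nat \<Rightarrow> nat set \<Rightarrow> (nat \<times> nat \<Rightarrow> nat) set" where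
  "fillings k h A =
     {T \<in> cells k h \<rightarrow>\<^sub>E A. inj_on T (cells k h) \<and>
        (\<forall>a b b'. (a, b) \<in> cells k h \<and> (a, b') \<in> cells k h \<and> b < b' \<longrightarrow> T (a, b) < T (a, b')) \<and>
        (\<forall>a a' b. (a, b) \<in> cells k h \<and> (a', b) \<in> cells k h \<and> a < a' \<longrightarrow> T (a, b) < T (a', b))}"

text \<open>
  Standard Young tableaux: there are as many cells as numbers, so an injective filling uses each
  number exactly once.  For \<open>h = 0\<close> there is exactly one (empty) filling.
\<close>

definition num_syt :: "nat \<Rightarrow> nat \<Rightarrow> nat" where
  "num_syt k h = card (fillings k h {1..k * h})"

definition int_binomial :: "nat \<Rightarrow> int \<Rightarrow> nat" where
  "int_binomial n j = (if j < 0 then 0 else n choose nat j)"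

end

theory Submission
  imports Defs "HOL-Library.Real_Mod"
begin

text \<open>
  Retracting the chain onto its \<open>i\<close>-th loop and summing positions along that loop gives a coordinate
  of a divisor modulo \<open>l i + m i\<close>; two divisors are equivalent iff they have the same degree and the
  same \<open>g\<close> coordinates.  Moving chips to the right as far as possible, one finds that a class of
  degree \<open>d\<close> is effective iff the following counter ends at most at \<open>d\<close>: it starts at \<open>0\<close>, and the
  \<open>i\<close>-th loop raises its value \<open>u\<close> by one unless the \<open>i\<close>-th coordinate is that of \<open>(d - u) Q\<^sub>i\<close>.
  Subtracting an effective divisor of degree \<open>r\<close> amounts to \<open>r\<close> additional unit jumps of the
  counter, and jumps made at the points \<open>Q\<^sub>i\<close> are the worst ones.  Let \<open>v\<^sub>i(j)\<close> be the largest value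
  that \<open>j\<close> jumps can force by the end of loop \<open>i\<close>.  The numbers \<open>i + j - v\<^sub>i(j)\<close>, \<open>0 \<le> j \<le> r\<close>, are the
  column heights of a Young diagram, which by genericity gains at most one box per loop, and the
  rank is at least \<open>r\<close> iff the final diagram contains the rectangle.  Recording the loops at which
  the boxes of the rectangle are added gives the tableau; the box in row \<open>a\<close> and column \<open>b\<close> can be
  added at loop \<open>i\<close> only if the \<open>i\<close>-th coordinate is that of \<open>(d - (i - 1 + b - a)) Q\<^sub>i\<close>.
\<close>


section \<open>Piecewise linear functions on an interval\<close>

lemma right_slope_eqI:
  assumes "\<forall>\<^sub>F x in at_right t. h x = h t + of_int n * (x - t)"
  shows "right_slope h t = n"
  unfolding right_slope_def
proof (rule the_equality)
  fix n' assume "\<forall>\<^sub>F x in at_right t. h x = h t + of_int n' * (x - t)"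
  with assms have "\<forall>\<^sub>F x in at_right t. n' = n"
    using eventually_at_right_less[of t] by eventually_elim auto
  then show "n' = n" by simp
qed (fact assms)

lemma left_slope_eqI:
  assumes "\<forall>\<^sub>F x in at_left t. h x = h t + of_int n * (x - t)"
  shows "left_slope h t = n"
  unfolding left_slope_def
proof (rule the_equality)
  fix n' assume "\<forall>\<^sub>F x in at_left t. h x = h t + of_int n' * (x - t)"
  moreover have "\<forall>\<^sub>F x in at_left t. x < t"
    by (simp add: eventually_at_filter)
  ultimately have "\<forall>\<^sub>F x in at_left t. n' = n"
    using assms by eventually_elim auto
  then show "n' = n" by simp
qed (fact assms)

text \<open>Hinge form: \<sigma> is the slope before all breakpoints and \<open>w u\<close> the drop
  of slope at \<open>u\<close>, that is, left slope minus right slope, the weight of the divisor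
  there.\<close>

definition pl_form :: "real \<Rightarrow> int \<Rightarrow> real set \<Rightarrow> (real \<Rightarrow> int) \<Rightarrow> real \<Rightarrow> real" where
  "pl_form A \<sigma> S w t = A + of_int \<sigma> * t - (\<Sum>u\<in>S. of_int (w u) * max 0 (t - u))"

lemma pl_form_diff:
  assumes "finite S" "s \<le> t" "S \<inter> {s<..<t} = {}"
  shows "pl_form A \<sigma> S w t - pl_form A \<sigma> S w s =
    of_int (\<sigma> - (\<Sum>u\<in>{u\<in>S. u \<le> s}. w u)) * (t - s)"
proof -
  have "(\<Sum>u\<in>S. of_int (w u) * max 0 (t - u)) - (\<Sum>u\<in>S. of_int (w u) * max 0 (s - u)) =
      (\<Sum>u\<in>S. if u \<le> s then of_int (w u) * (t - s) else 0)"
    unfolding sum_subtractf[symmetric]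
  proof (rule sum.cong)
    fix u assume "u \<in> S"
    then have "u \<le> s \<or> t \<le> u" using assms(3) by force
    then show "of_int (w u) * max 0 (t - u) - of_int (w u) * max 0 (s - u) =
        (if u \<le> s then of_int (w u) * (t - s) else 0)"
      using assms(2) by (auto simp: max_def right_diff_distrib)
  qed simp
  also have "\<dots> = (\<Sum>u\<in>{u\<in>S. u \<le> s}. of_int (w u) * (t - s))"
    using assms by (simp add: sum.If_cases Int_def)
  finally show ?thesis
    unfolding pl_form_def of_int_diff of_int_sum left_diff_distrib sum_distrib_right
    by (simp add: right_diff_distrib)
qed

lemma avoid_finite_right:
  fixes t a :: real
  assumes "finite S" "t < a"
  obtains b where "t < b" "b \<le> a" "S \<inter> {t<..<b} = {}"
proof
  let ?b = "Min (insert a (S \<inter> {t<..}))"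
  have fin: "finite (insert a (S \<inter> {t<..}))" using assms by auto
  show "t < ?b" using assms fin by (subst Min_gr_iff) auto
  show "?b \<le> a" using fin by (intro Min_le) auto
  show "S \<inter> {t<..<?b} = {}"
    using fin by (auto simp: Min_gr_iff simp del: Min_insert)
qed

lemma avoid_finite_left:
  fixes t a :: real
  assumes "finite S" "a < t"
  obtains b where "b < t" "a \<le> b" "S \<inter> {b<..<t} = {}"
proof
  let ?b = "Max (insert a (S \<inter> {..<t}))"
  have fin: "finite (insert a (S \<inter> {..<t}))" using assms by auto
  show "?b < t" using assms fin by (subst Max_less_iff) auto
  show "a \<le> ?b" using fin by (intro Max_ge) auto
  show "S \<inter> {?b<..<t} = {}"
    using fin by (auto simp: Max_less_iff simp del: Max_insert)
qed

lemma right_slope_pl_form: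
  assumes "finite S" "0 \<le> t" "t < a" and h: "\<And>x. 0 \<le> x \<Longrightarrow> x \<le> a \<Longrightarrow> h x = pl_form A \<sigma> S w x"
  shows "right_slope h t = \<sigma> - (\<Sum>u\<in>{u\<in>S. u \<le> t}. w u)"
proof (rule right_slope_eqI)
  obtain b where b: "t < b" "b \<le> a" "S \<inter> {t<..<b} = {}"
    using avoid_finite_right[OF \<open>finite S\<close> \<open>t < a\<close>] .
  have "h x = h t + of_int (\<sigma> - (\<Sum>u\<in>{u\<in>S. u \<le> t}. w u)) * (x - t)" if "t < x" "x < b" for x
    using pl_form_diff[of S t x A \<sigma> w] that b assms by (force simp: h)
  then show "\<forall>\<^sub>F x in at_right t. h x = h t + of_int (\<sigma> - (\<Sum>u\<in>{u\<in>S. u \<le> t}. w u)) * (x - t)"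
    using b(1) by (auto simp: eventually_at_right)
qed

lemma left_slope_pl_form:
  assumes "finite S" "0 < t" "t \<le> a" and h: "\<And>x. 0 \<le> x \<Longrightarrow> x \<le> a \<Longrightarrow> h x = pl_form A \<sigma> S w x"
  shows "left_slope h t = \<sigma> - (\<Sum>u\<in>{u\<in>S. u < t}. w u)"
proof (rule left_slope_eqI)
  obtain b where b: "b < t" "0 \<le> b" "S \<inter> {b<..<t} = {}"
    using avoid_finite_left[OF \<open>finite S\<close> \<open>0 < t\<close>] .
  have "h x = h t + of_int (\<sigma> - (\<Sum>u\<in>{u\<in>S. u < t}. w u)) * (x - t)" if "b < x" "x < t" for x
  proof -
    have "{u\<in>S. u \<le> x} = {u\<in>S. u < t}" using that b by force
    then show ?thesis
      using pl_form_diff[of S x t A \<sigma> w] that b assms by (force simp: h algebra_simps)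
  qed
  then show "\<forall>\<^sub>F x in at_left t. h x = h t + of_int (\<sigma> - (\<Sum>u\<in>{u\<in>S. u < t}. w u)) * (x - t)"
    using b(1) by (auto simp: eventually_at_left)
qed

lemma integral_pl_on_pl_form:
  assumes "finite S" and h: "\<And>x. 0 \<le> x \<Longrightarrow> x \<le> a \<Longrightarrow> h x = pl_form A \<sigma> S w x"
  shows "integral_pl_on a h"
  unfolding integral_pl_on_def
proof (intro conjI exI[of _ S] allI impI)
  have "continuous_on {0..a} (pl_form A \<sigma> S w)"
    unfolding pl_form_def by (intro continuous_intros)
  then show "continuous_on {0..a} h"
    by (subst continuous_on_cong[OF refl, where g = "pl_form A \<sigma> S w"]) (auto simp: h)
next
  fix s t assume st: "0 \<le> s \<and> s < t \<and> t \<le> a \<and> {s<..<t} \<inter> S = {}"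
  let ?n = "\<sigma> - (\<Sum>u\<in>{u\<in>S. u \<le> s}. w u)"
  have "h x = (h s - of_int ?n * s) + of_int ?n * x" if "x \<in> {s<..<t}" for x
    using pl_form_diff[of S s x A \<sigma> w] that st assms by (force simp: h algebra_simps)
  then show "\<exists>(n::int) c. \<forall>x\<in>{s<..<t}. h x = c + of_int n * x" by blast
qed (fact assms)

lemma affine_on_closed_interval:
  fixes h :: "real \<Rightarrow> real"
  assumes cont: "continuous_on {a..b} h" and "a < b"
    and h: "\<And>x. a < x \<Longrightarrow> x < b \<Longrightarrow> h x = c + n * x" and "x \<in> {a..b}"
  shows "h x = c + n * x"
proof -
  have "h x - (c + n * x) = 0"
  proof (rule continuous_constant_on_closure[where S = "{a<..<b}" and f = "\<lambda>x. h x - (c + n * x)"])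
    show "continuous_on (closure {a<..<b}) (\<lambda>x. h x - (c + n * x))"
      using cont \<open>a < b\<close> by (auto intro!: continuous_intros)
  qed (use assms in auto)
  then show ?thesis by simp
qed

text \<open>Induction on the number of candidate breakpoints inside the interval: the form up to the
  last one, \<open>b\<close>, is continued by one more hinge. The interval shrinks in the induction,
  hence the predicate \<open>breaks\<close> with variable length.\<close>

lemma integral_pl_on_imp_pl_form:
  assumes "integral_pl_on a h" "0 < a"
  obtains A \<sigma> S w where "finite S" "S \<subseteq> {0<..<a}"
    "\<And>t. 0 \<le> t \<Longrightarrow> t \<le> a \<Longrightarrow> h t = pl_form A \<sigma> S w t"
proof -
  define breaks where "breaks B a \<longleftrightarrow> finite B \<and>
     (\<forall>s t. 0 \<le> s \<and> s < t \<and> t \<le> a \<and> {s<..<t} \<inter> B = {} \<longrightarrow>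
        (\<exists>(n::int) c. \<forall>x\<in>{s<..<t}. h x = c + of_int n * x))" for B a
  have form: "\<exists>A \<sigma> S w. finite S \<and> S \<subseteq> {0<..<a} \<and> (\<forall>t. 0 \<le> t \<and> t \<le> a \<longrightarrow> h t = pl_form A \<sigma> S w t)"
    if "breaks B a" "continuous_on {0..a} h" "0 < a" for B a
    using that
  proof (induction "card (B \<inter> {0<..<a})" arbitrary: a rule: less_induct)
    case less
    have fin: "finite (B \<inter> {0<..<a})" using less.prems by (auto simp: breaks_def)
    show ?case
    proof (cases "B \<inter> {0<..<a} = {}")
      case True
      then obtain n :: int and c where "\<forall>x\<in>{0<..<a}. h x = c + of_int n * x"
        using less.prems(1,3) unfolding breaks_def
        by (metis Int_commute order_refl)
      then have "h t = pl_form c n {} (\<lambda>_. 0) t" if "0 \<le> t" "t \<le> a" for t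
        using affine_on_closed_interval[of 0 a h c "of_int n" t] that less.prems
        by (auto simp: pl_form_def)
      then show ?thesis by (intro exI[of _ c] exI[of _ n] exI[of _ "{}"] exI[of _ "\<lambda>_. 0"]) auto
    next
      case False
      define b where "b = Max (B \<inter> {0<..<a})"
      have bB: "b \<in> B \<inter> {0<..<a}" unfolding b_def using fin False by (rule Max_in)
      have b_max: "x \<le> b" if "x \<in> B \<inter> {0<..<a}" for x
        unfolding b_def using fin that by (rule Max_ge)
      have "B \<inter> {0<..<b} \<subset> B \<inter> {0<..<a}" using bB by auto
      then have "card (B \<inter> {0<..<b}) < card (B \<inter> {0<..<a})"
        using fin by (rule psubset_card_mono[rotated])
      moreover have "breaks B b" using less.prems(1) bB unfolding breaks_def by force
      moreover have "continuous_on {0..b} h"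
        using less.prems(2) bB by (auto intro: continuous_on_subset)
      ultimately obtain A \<sigma> S w where S: "finite S" "S \<subseteq> {0<..<b}"
        and h: "\<And>t. 0 \<le> t \<Longrightarrow> t \<le> b \<Longrightarrow> h t = pl_form A \<sigma> S w t"
        using less.hyps[of b] bB by auto
      have "{b<..<a} \<inter> B = {}" using bB b_max by force
      then obtain n :: int and c where "\<forall>x\<in>{b<..<a}. h x = c + of_int n * x"
        using less.prems(1) bB unfolding breaks_def
        by (metis IntD2 greaterThanLessThan_iff less_imp_le order_refl)
      then have aff: "h t = c + of_int n * t" if "b \<le> t" "t \<le> a" for t
        using affine_on_closed_interval[of b a h c "of_int n" t] that bB
          continuous_on_subset[OF less.prems(2), of "{b..a}"] by auto
      \<comment> \<open>The new drop turns the final slope \<open>\<sigma> - sum w S\<close> left of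
        \<open>b\<close> into the slope \<open>n\<close> right of it.\<close>
      define w' where "w' = w(b := \<sigma> - sum w S - n)"
      have split: "pl_form A \<sigma> (insert b S) w' t =
          pl_form A \<sigma> S w t - of_int (\<sigma> - sum w S - n) * max 0 (t - b)" for t
      proof -
        have "(\<Sum>u\<in>S. of_int (w' u) * max 0 (t - u)) = (\<Sum>u\<in>S. of_int (w u) * max 0 (t - u))"
          using S(2) by (intro sum.cong) (auto simp: w'_def)
        moreover have "b \<notin> S" using S(2) by auto
        ultimately show ?thesis using S(1) by (simp add: pl_form_def w'_def)
      qed
      have "h t = pl_form A \<sigma> (insert b S) w' t" if "0 \<le> t" "t \<le> a" for t
      proof (cases "t \<le> b")
        case True
        then show ?thesis using h[of t] that by (simp add: split)
      next
        case False
        have "{u \<in> S. u \<le> b} = S" using S by auto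
        moreover have "S \<inter> {b<..<t} = {}" using S(2) by force
        ultimately have "pl_form A \<sigma> S w t - pl_form A \<sigma> S w b = of_int (\<sigma> - sum w S) * (t - b)"
          using pl_form_diff[of S b t A \<sigma> w] S False by simp
        then show ?thesis
          using aff[of t] aff[of b] h[of b] bB False that by (simp add: split algebra_simps)
      qed
      then show ?thesis using S bB
        by (intro exI[of _ A] exI[of _ \<sigma>] exI[of _ "insert b S"] exI[of _ w']) auto
    qed
  qed
  obtain B where "breaks B a" "continuous_on {0..a} h"
    using assms(1) by (auto simp: integral_pl_on_def breaks_def)
  from form[OF this assms(2)] show thesis using that by blast
qed


section \<open>Weighted sums over divisors\<close>

text \<open>Integer weights count chips, real weights add up positions. Identities between such sums
  reduce by \<open>div_sum_cong\<close> to identities of weights at a single point.\<close>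

definition div_sum :: "('a \<Rightarrow> 'b::comm_ring_1) \<Rightarrow> ('a \<Rightarrow>\<^sub>0 int) \<Rightarrow> 'b" where
  "div_sum \<phi> D = (\<Sum>p\<in>Poly_Mapping.keys D. of_int (Poly_Mapping.lookup D p) * \<phi> p)"

lemma div_sum_superset:
  assumes "finite S" "Poly_Mapping.keys D \<subseteq> S"
  shows "div_sum \<phi> D = (\<Sum>p\<in>S. of_int (Poly_Mapping.lookup D p) * \<phi> p)"
  unfolding div_sum_def using assms by (intro sum.mono_neutral_left) (auto simp: in_keys_iff)

lemma div_sum_0 [simp]: "div_sum \<phi> 0 = 0"
  by (simp add: div_sum_def)

lemma div_sum_add: "div_sum \<phi> (D + E) = div_sum \<phi> D + div_sum \<phi> E"
proof -
  let ?S = "Poly_Mapping.keys D \<union> Poly_Mapping.keys E"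
  have "Poly_Mapping.keys (D + E) \<subseteq> ?S" by (rule Poly_Mapping.keys_add)
  then show ?thesis
    by (simp add: div_sum_superset[of ?S] lookup_add sum.distrib[symmetric] distrib_right)
qed

lemma div_sum_diff: "div_sum \<phi> (D - E) = div_sum \<phi> D - div_sum \<phi> E"
  using div_sum_add[of \<phi> "D - E" E] by (simp add: algebra_simps)

lemma div_sum_sum: "div_sum \<phi> (\<Sum>i\<in>I. D i) = (\<Sum>i\<in>I. div_sum \<phi> (D i))"
  by (induction I rule: infinite_finite_induct) (simp_all add: div_sum_add)

lemma div_sum_frag_of [simp]: "div_sum \<phi> (frag_of p) = \<phi> p"
  by (simp add: div_sum_def keys_frag_of)

lemma div_sum_frag_cmul: "div_sum \<phi> (frag_cmul n D) = of_int n * div_sum \<phi> D"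
proof -
  have "div_sum \<phi> (frag_cmul n D) =
      (\<Sum>p\<in>Poly_Mapping.keys D. of_int (Poly_Mapping.lookup (frag_cmul n D) p) * \<phi> p)"
    by (rule div_sum_superset) (auto simp: keys_cmul)
  then show ?thesis by (simp add: div_sum_def sum_distrib_left mult.assoc)
qed

lemma div_sum_cong: "(\<And>p. p \<in> Poly_Mapping.keys D \<Longrightarrow> \<phi> p = \<psi> p) \<Longrightarrow> div_sum \<phi> D = div_sum \<psi> D"
  by (simp add: div_sum_def)

lemma div_sum_fun_add: "div_sum (\<lambda>p. \<phi> p + \<psi> p) D = div_sum \<phi> D + div_sum \<psi> D"
  by (simp add: div_sum_def distrib_left sum.distrib)

lemma div_sum_fun_diff: "div_sum (\<lambda>p. \<phi> p - \<psi> p) D = div_sum \<phi> D - div_sum \<psi> D"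
  by (simp add: div_sum_def right_diff_distrib sum_subtractf)

lemma div_sum_fun_cmul: "div_sum (\<lambda>p. a * \<phi> p) D = a * div_sum \<phi> D"
  by (simp add: div_sum_def sum_distrib_left mult_ac)

lemma of_int_div_sum: "of_int (div_sum \<phi> D) = div_sum (\<lambda>p. of_int (\<phi> p)) D"
  by (simp add: div_sum_def)

lemma degree_eq_div_sum: "degree D = div_sum (\<lambda>_. 1) D"
  by (simp add: degree_def div_sum_def)

lemma div_sum_mono:
  fixes \<phi> \<psi> :: "('v, 'e) gpoint \<Rightarrow> int"
  assumes "effective D" "\<And>p. p \<in> Poly_Mapping.keys D \<Longrightarrow> \<phi> p \<le> \<psi> p"
  shows "div_sum \<phi> D \<le> div_sum \<psi> D"
  unfolding div_sum_def using assms by (intro sum_mono mult_left_mono) (auto simp: effective_def)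

lemma div_sum_eq_0_effective:
  fixes \<phi> :: "('v, 'e) gpoint \<Rightarrow> int"
  assumes "effective D" "div_sum \<phi> D \<le> 0" "\<And>p. 0 \<le> \<phi> p" "p \<in> Poly_Mapping.keys D"
  shows "\<phi> p = 0"
proof -
  have "0 \<le> div_sum \<phi> D" using div_sum_mono[of D "\<lambda>_. 0" \<phi>] assms by (simp add: div_sum_def)
  then have "div_sum \<phi> D = 0" using assms(2) by simp
  then have "of_int (Poly_Mapping.lookup D p) * \<phi> p = 0"
    unfolding div_sum_def using assms
    by (subst (asm) sum_nonneg_eq_0_iff) (auto simp: effective_def)
  then show ?thesis using assms(4) by (simp add: in_keys_iff)
qed

lemma in_divisors_iff: "D \<in> divisors G \<longleftrightarrow> Poly_Mapping.keys D \<subseteq> points G"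
  by (simp add: divisors_def)

lemma zero_in_divisors [simp]: "0 \<in> divisors G"
  by (simp add: in_divisors_iff)

lemma add_in_divisors: "D \<in> divisors G \<Longrightarrow> E \<in> divisors G \<Longrightarrow> D + E \<in> divisors G"
  unfolding in_divisors_iff using Poly_Mapping.keys_add[of D E] by blast

lemma diff_in_divisors: "D \<in> divisors G \<Longrightarrow> E \<in> divisors G \<Longrightarrow> D - E \<in> divisors G"
  unfolding in_divisors_iff using keys_diff[of D E] by blast

lemma frag_of_in_divisors: "p \<in> points G \<Longrightarrow> frag_of p \<in> divisors G"
  by (simp add: in_divisors_iff keys_frag_of)

lemma frag_cmul_in_divisors: "D \<in> divisors G \<Longrightarrow> frag_cmul n D \<in> divisors G"
  unfolding in_divisors_iff using keys_cmul[of n D] by blast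

lemma sum_in_divisors: "(\<And>i. i \<in> I \<Longrightarrow> D i \<in> divisors G) \<Longrightarrow> (\<Sum>i\<in>I. D i) \<in> divisors G"
  by (induction I rule: infinite_finite_induct) (auto intro: add_in_divisors)


section \<open>Principal divisors on a metric graph\<close>

text \<open>Extension by zero turns a sum over the chips inside one edge into a
  \<open>div_sum\<close> over the whole divisor.\<close>

definition on_edge :: "'e \<Rightarrow> (real \<Rightarrow> 'b::zero) \<Rightarrow> ('v, 'e) gpoint \<Rightarrow> 'b" where
  "on_edge e f p = (case p of Vertex v \<Rightarrow> 0 | Inner e' u \<Rightarrow> if e' = e then f u else 0)"

lemma on_edge_simps [simp]:
  "on_edge e f (Vertex v) = 0"
  "on_edge e f (Inner e' u) = (if e' = e then f u else 0)"
  by (simp_all add: on_edge_def)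

lemma div_sum_on_edge:
  assumes "finite S" "\<And>u. Inner e u \<in> Poly_Mapping.keys D \<Longrightarrow> u \<in> S"
  shows "div_sum (on_edge e f) D = (\<Sum>u\<in>S. of_int (Poly_Mapping.lookup D (Inner e u)) * f u)"
proof -
  let ?K = "Poly_Mapping.keys D \<union> Inner e ` S"
  have "div_sum (on_edge e f) D = (\<Sum>p\<in>?K. of_int (Poly_Mapping.lookup D p) * on_edge e f p)"
    using assms by (intro div_sum_superset) auto
  also have "\<dots> = (\<Sum>p\<in>Inner e ` S. of_int (Poly_Mapping.lookup D p) * on_edge e f p)"
  proof (rule sum.mono_neutral_right)
    show "\<forall>p\<in>?K - Inner e ` S. of_int (Poly_Mapping.lookup D p) * on_edge e f p = 0"
    proof
      fix p assume "p \<in> ?K - Inner e ` S"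
      then show "of_int (Poly_Mapping.lookup D p) * on_edge e f p = 0"
        using assms(2) by (cases p) auto
    qed
  qed (use assms in auto)
  also have "\<dots> = (\<Sum>u\<in>S. of_int (Poly_Mapping.lookup D (Inner e u)) * f u)"
    by (subst sum.reindex) (auto simp: inj_on_def)
  finally show ?thesis .
qed

lemma finite_support_on_edge: "finite {u. Inner e u \<in> Poly_Mapping.keys D}"
proof -
  have "finite (Inner e -` Poly_Mapping.keys D)"
    by (rule finite_vimageI) (auto simp: inj_on_def)
  then show ?thesis by (simp add: vimage_def)
qed

text \<open>The assumption on \<open>h\<close> describes a function with initial slope \<sigma>
  whose slope drops at each chip inside \<open>e\<close> by the weight of that chip.\<close>

context
  fixes G :: "('v, 'e) metric_graph" and D :: "('v, 'e) divisor" and h :: "real \<Rightarrow> real"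
    and e :: 'e and A :: real and \<sigma> :: int
  assumes e: "e \<in> edges G" "0 < len G e" and D: "D \<in> divisors G"
    and h: "\<And>t. 0 \<le> t \<Longrightarrow> t \<le> len G e \<Longrightarrow>
      h t = A + of_int \<sigma> * t - div_sum (on_edge e (\<lambda>u. max 0 (t - u))) D"
begin

lemma support_on_edge_bounds:
  assumes "Inner e u \<in> Poly_Mapping.keys D"
  shows "0 < u" "u < len G e"
  using assms D by (auto simp: in_divisors_iff points_def)

lemma edge_function_pl_form:
  assumes "0 \<le> t" "t \<le> len G e"
  shows "h t = pl_form A \<sigma> {u. Inner e u \<in> Poly_Mapping.keys D} (\<lambda>u. Poly_Mapping.lookup D (Inner e u)) t"
  using h[OF assms] div_sum_on_edge[OF finite_support_on_edge[of e D], of e D "\<lambda>u. max 0 (t - u)"]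
  by (simp add: pl_form_def)

lemma edge_function_integral_pl: "integral_pl_on (len G e) h"
  using edge_function_pl_form by (intro integral_pl_on_pl_form[OF finite_support_on_edge[of e D]])

lemma edge_function_right_slope_0: "right_slope h 0 = \<sigma>"
proof -
  let ?S = "{u. Inner e u \<in> Poly_Mapping.keys D}"
  have "{u\<in>?S. u \<le> 0} = {}" using support_on_edge_bounds by force
  then show ?thesis
    using right_slope_pl_form[OF finite_support_on_edge[of e D] order_refl e(2) edge_function_pl_form]
    by (metis (no_types, lifting) diff_zero sum.empty)
qed

lemma edge_function_left_slope_len:
  "left_slope h (len G e) = \<sigma> - div_sum (on_edge e (\<lambda>_. 1)) D"
proof -
  let ?S = "{u. Inner e u \<in> Poly_Mapping.keys D}"
  have "{u\<in>?S. u < len G e} = ?S" using support_on_edge_bounds by force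
  moreover have "div_sum (on_edge e (\<lambda>_. 1)) D = (\<Sum>u\<in>?S. Poly_Mapping.lookup D (Inner e u))"
    by (subst div_sum_on_edge[OF finite_support_on_edge[of e D]]) auto
  ultimately show ?thesis
    using left_slope_pl_form[OF finite_support_on_edge[of e D] e(2) order_refl edge_function_pl_form]
    by simp
qed

lemma edge_function_slope_change:
  assumes "0 < t" "t < len G e"
  shows "left_slope h t - right_slope h t = Poly_Mapping.lookup D (Inner e t)"
proof -
  let ?S = "{u. Inner e u \<in> Poly_Mapping.keys D}" and ?w = "\<lambda>u. Poly_Mapping.lookup D (Inner e u)"
  have "left_slope h t - right_slope h t = sum ?w {u\<in>?S. u \<le> t} - sum ?w {u\<in>?S. u < t}"
    using left_slope_pl_form[OF finite_support_on_edge[of e D] _ _ edge_function_pl_form, where a = "len G e" and t = t]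
      right_slope_pl_form[OF finite_support_on_edge[of e D] _ _ edge_function_pl_form, where a = "len G e" and t = t] assms
    by simp
  also have "sum ?w {u\<in>?S. u \<le> t} = sum ?w (insert t {u\<in>?S. u < t})"
    using finite_support_on_edge[of e D]
    by (intro sum.mono_neutral_left) (auto simp: in_keys_iff)
  also have "\<dots> = ?w t + sum ?w {u\<in>?S. u < t}"
    using finite_support_on_edge[of e D] by simp
  finally show ?thesis by simp
qed

end

text \<open>At an inner point the weight of \<open>D\<close> and the hinge coefficient are both the
  drop of slope, so the hinge sum becomes a sum over \<open>D\<close>.\<close>

lemma edge_function_of_divisor:
  assumes e: "e \<in> edges G" "0 < len G e" and f: "graph_function G f" "is_divisor_of G D f"
  obtains \<sigma> where "\<And>t. 0 \<le> t \<Longrightarrow> t \<le> len G e \<Longrightarrow> f (edge_point G e t) =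
    f (Vertex (source G e)) + of_int \<sigma> * t - div_sum (on_edge e (\<lambda>u. max 0 (t - u))) D"
proof -
  let ?h = "\<lambda>t. f (edge_point G e t)"
  have "integral_pl_on (len G e) ?h" using e f by (auto simp: graph_function_def)
  then obtain A \<sigma> S w where S: "finite S" "S \<subseteq> {0<..<len G e}"
    and h: "\<And>t. 0 \<le> t \<Longrightarrow> t \<le> len G e \<Longrightarrow> ?h t = pl_form A \<sigma> S w t"
    by (rule integral_pl_on_imp_pl_form[OF _ e(2)]) (rule that)
  have lookup: "Poly_Mapping.lookup D (Inner e u) = (if u \<in> S then w u else 0)"
    if u: "0 < u" "u < len G e" for u
  proof -
    have "Inner e u \<in> points G" using e u by (auto simp: points_def)
    then have "Poly_Mapping.lookup D (Inner e u) = left_slope ?h u - right_slope ?h u"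
      using f(2) unfolding is_divisor_of_def by (metis incoming_slopes.simps(2))
    also have "\<dots> = sum w {v\<in>S. v \<le> u} - sum w {v\<in>S. v < u}"
      using left_slope_pl_form[OF S(1) _ _ h, where a = "len G e" and t = u]
        right_slope_pl_form[OF S(1) _ _ h, where a = "len G e" and t = u] u by simp
    also have "{v\<in>S. v \<le> u} = (if u \<in> S then insert u {v\<in>S. v < u} else {v\<in>S. v < u})"
      by (auto simp: order_le_less)
    finally show ?thesis using S(1) by simp
  qed
  have supp: "u \<in> S" if "Inner e u \<in> Poly_Mapping.keys D" for u
  proof -
    have "Inner e u \<in> points G"
      using that f(2) by (auto simp: is_divisor_of_def in_divisors_iff)
    then have "0 < u" "u < len G e" by (auto simp: points_def)
    then show ?thesis using lookup[of u] that by (auto simp: in_keys_iff split: if_splits)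
  qed
  have sum: "div_sum (on_edge e (\<lambda>u. max 0 (t - u))) D = (\<Sum>u\<in>S. of_int (w u) * max 0 (t - u))" for t
  proof -
    have "div_sum (on_edge e (\<lambda>u. max 0 (t - u))) D =
        (\<Sum>u\<in>S. of_int (Poly_Mapping.lookup D (Inner e u)) * max 0 (t - u))"
      using S(1) supp by (rule div_sum_on_edge)
    also have "\<dots> = (\<Sum>u\<in>S. of_int (w u) * max 0 (t - u))"
      using S(2) by (intro sum.cong) (auto simp: lookup)
    finally show ?thesis .
  qed
  have "(\<Sum>u\<in>S. of_int (w u) * max 0 (0 - u)) = 0"
    using S(2) by (intro sum.neutral) (auto simp: max_def)
  then have "f (Vertex (source G e)) = A"
    using h[of 0] e(2) by (simp add: pl_form_def edge_point_def)
  then show thesis using that[of \<sigma>] h sum by (simp add: pl_form_def)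
qed

definition principal :: "('v, 'e) metric_graph \<Rightarrow> ('v, 'e) divisor \<Rightarrow> bool" where
  "principal G D \<longleftrightarrow> (\<exists>f. graph_function G f \<and> is_divisor_of G D f)"

text \<open>
  A function is determined by its values \<open>A\<close> at the vertices, its initial slopes \<open>\<sigma>\<close> on the edges
  and its divisor.
\<close>

lemma principal_iff_slopes:
  assumes wf: "wf_metric_graph G" and D: "D \<in> divisors G"
  shows "principal G D \<longleftrightarrow> (\<exists>A (\<sigma> :: 'e \<Rightarrow> int).
    (\<forall>e\<in>edges G. A (target G e) = A (source G e) + of_int (\<sigma> e) * len G e -
       div_sum (on_edge e (\<lambda>u. len G e - u)) D) \<and>
    (\<forall>v\<in>verts G. Poly_Mapping.lookup D (Vertex v) =
       (\<Sum>e\<in>{e \<in> edges G. target G e = v}. \<sigma> e - div_sum (on_edge e (\<lambda>_. 1)) D) -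
       (\<Sum>e\<in>{e \<in> edges G. source G e = v}. \<sigma> e)))"
    (is "_ \<longleftrightarrow> (\<exists>A \<sigma>. ?heights A \<sigma> \<and> ?slopes \<sigma>)")
proof
  note len_pos = wf[unfolded wf_metric_graph_def]
  have end_sum: "div_sum (on_edge e (\<lambda>u. max 0 (len G e - u))) D = div_sum (on_edge e (\<lambda>u. len G e - u)) D" for e
  proof (rule div_sum_cong)
    fix p assume "p \<in> Poly_Mapping.keys D"
    then show "on_edge e (\<lambda>u. max 0 (len G e - u)) p = on_edge e (\<lambda>u. len G e - u) p"
      using D by (cases p) (auto simp: in_divisors_iff points_def max_def)
  qed
  {
    assume "principal G D"
    then obtain f where f: "graph_function G f" "is_divisor_of G D f"
      by (auto simp: principal_def)
    define A where "A v = f (Vertex v)" for v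
    have "\<forall>e\<in>edges G. \<exists>\<sigma>. \<forall>t. 0 \<le> t \<longrightarrow> t \<le> len G e \<longrightarrow> f (edge_point G e t) =
        A (source G e) + of_int \<sigma> * t - div_sum (on_edge e (\<lambda>u. max 0 (t - u))) D"
      using edge_function_of_divisor[OF _ _ f] len_pos unfolding A_def by metis
    then obtain \<sigma> :: "'e \<Rightarrow> int" where \<sigma>:
      "\<And>e t. e \<in> edges G \<Longrightarrow> 0 \<le> t \<Longrightarrow> t \<le> len G e \<Longrightarrow> f (edge_point G e t) =
        A (source G e) + of_int (\<sigma> e) * t - div_sum (on_edge e (\<lambda>u. max 0 (t - u))) D"
      by metis
    have "?heights A \<sigma>"
    proof
      fix e assume e: "e \<in> edges G"
      then have pos: "0 < len G e" using len_pos by auto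
      have "A (target G e) = f (edge_point G e (len G e))"
        using pos by (simp add: edge_point_def A_def)
      then show "A (target G e) = A (source G e) + of_int (\<sigma> e) * len G e -
          div_sum (on_edge e (\<lambda>u. len G e - u)) D"
        using \<sigma>[OF e, of "len G e"] pos end_sum by simp
    qed
    moreover have "?slopes \<sigma>"
    proof
      fix v assume "v \<in> verts G"
      then have "Poly_Mapping.lookup D (Vertex v) = incoming_slopes G f (Vertex v)"
        using f by (auto simp: is_divisor_of_def points_def)
      also have "\<dots> = (\<Sum>e\<in>{e \<in> edges G. target G e = v}. \<sigma> e - div_sum (on_edge e (\<lambda>_. 1)) D) +
         (\<Sum>e\<in>{e \<in> edges G. source G e = v}. - \<sigma> e)"
        unfolding incoming_slopes.simps
        using len_pos edge_function_left_slope_len[OF _ _ D \<sigma>] edge_function_right_slope_0[OF _ _ D \<sigma>]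
        by (intro arg_cong2[where f = "(+)"] sum.cong) auto
      finally show "Poly_Mapping.lookup D (Vertex v) =
         (\<Sum>e\<in>{e \<in> edges G. target G e = v}. \<sigma> e - div_sum (on_edge e (\<lambda>_. 1)) D) -
         (\<Sum>e\<in>{e \<in> edges G. source G e = v}. \<sigma> e)"
        by (simp add: sum_negf)
    qed
    ultimately show "\<exists>A \<sigma>. ?heights A \<sigma> \<and> ?slopes \<sigma>" by blast
  next
    assume "\<exists>A \<sigma>. ?heights A \<sigma> \<and> ?slopes \<sigma>"
    then obtain A and \<sigma> :: "'e \<Rightarrow> int" where A: "?heights A \<sigma>" and \<sigma>: "?slopes \<sigma>" by blast
    define F where "F e t = A (source G e) + of_int (\<sigma> e) * t - div_sum (on_edge e (\<lambda>u. max 0 (t - u))) D"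
      for e t
    define f where "f p = (case p of Vertex v \<Rightarrow> A v | Inner e t \<Rightarrow> F e t)" for p
    have F_0: "F e 0 = A (source G e)" for e
    proof -
      have "div_sum (on_edge e (\<lambda>u. max 0 (0 - u))) D = div_sum (\<lambda>_. 0) D"
      proof (rule div_sum_cong)
        fix p assume "p \<in> Poly_Mapping.keys D"
        then show "on_edge e (\<lambda>u. max 0 (0 - u)) p = 0"
          using D by (cases p) (auto simp: in_divisors_iff points_def max_def)
      qed
      then show ?thesis by (simp add: F_def div_sum_def)
    qed
    have f: "f (edge_point G e t) =
        A (source G e) + of_int (\<sigma> e) * t - div_sum (on_edge e (\<lambda>u. max 0 (t - u))) D"
      if "e \<in> edges G" "0 \<le> t" "t \<le> len G e" for e t
    proof -
      have "F e (len G e) = A (target G e)" using A that end_sum by (simp add: F_def)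
      then have "f (edge_point G e t) = F e t"
        using that F_0 by (auto simp: edge_point_def f_def)
      then show ?thesis by (simp add: F_def)
    qed
    have "graph_function G f"
      unfolding graph_function_def using len_pos edge_function_integral_pl[OF _ _ D f] by blast
    moreover have "Poly_Mapping.lookup D p = incoming_slopes G f p" if "p \<in> points G" for p
    proof (cases p)
      case (Vertex v)
      then have "v \<in> verts G" using that by (auto simp: points_def)
      have "incoming_slopes G f (Vertex v) =
         (\<Sum>e\<in>{e \<in> edges G. target G e = v}. \<sigma> e - div_sum (on_edge e (\<lambda>_. 1)) D) +
         (\<Sum>e\<in>{e \<in> edges G. source G e = v}. - \<sigma> e)"
        unfolding incoming_slopes.simps
        using len_pos edge_function_left_slope_len[OF _ _ D f] edge_function_right_slope_0[OF _ _ D f]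
        by (intro arg_cong2[where f = "(+)"] sum.cong) auto
      then show ?thesis using \<sigma> \<open>v \<in> verts G\<close> by (simp add: Vertex sum_negf)
    next
      case (Inner e t)
      then have "e \<in> edges G" "0 < t" "t < len G e" using that by (auto simp: points_def)
      then show ?thesis
        using edge_function_slope_change[OF _ _ D f] len_pos by (simp add: Inner)
    qed
    ultimately show "principal G D"
      using D by (auto simp: principal_def is_divisor_of_def)
  }
qed


section \<open>The Jacobian of a chain of loops\<close>

text \<open>Orders the chain from left to right: even values for the marked points,
  \<open>2 * i - 1\<close> for the interior of the \<open>i\<close>-th loop. Thus
  \<open>chips (2 * i - 1)\<close> counts up to and including \<open>Q_(i-1)\<close>, and
  \<open>chips (2 * i)\<close> everything before \<open>Q_i\<close>.\<close>

fun position :: "(nat, chain_edge) gpoint \<Rightarrow> nat" where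
  "position (Vertex v) = 2 * v"
| "position (Inner e t) = 2 * edge_index e - 1"

definition chips :: "nat \<Rightarrow> (nat, chain_edge) divisor \<Rightarrow> int" where
  "chips n D = div_sum (\<lambda>p. of_bool (position p < n)) D"

text \<open>
  The retraction of the chain onto its \<open>i\<close>-th loop, followed by the parametrization of that loop by
  the real line modulo \<open>l i + m i\<close> in which \<open>Q\<^sub>i\<^sub>-\<^sub>1\<close> is \<open>0\<close> and \<open>Q\<^sub>i\<close> is \<open>l i\<close>, equivalently \<open>- m i\<close>.
\<close>

definition coord :: "(nat \<Rightarrow> real) \<Rightarrow> nat \<Rightarrow> (nat, chain_edge) gpoint \<Rightarrow> real" where
  "coord l i p =
     (if position p + 1 < 2 * i then 0
      else if 2 * i \<le> position p then l i
      else case p of Vertex v \<Rightarrow> 0 | Inner e t \<Rightarrow> (case e of Seg_L j \<Rightarrow> t | Seg_M j \<Rightarrow> - t))"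

lemma lookup_eq_div_sum: "Poly_Mapping.lookup D p = div_sum (\<lambda>q. of_bool (q = p) :: int) D"
proof -
  have "div_sum (\<lambda>q. of_bool (q = p) :: int) D =
      (\<Sum>q\<in>insert p (Poly_Mapping.keys D). of_int (Poly_Mapping.lookup D q) * of_bool (q = p))"
    by (rule div_sum_superset) auto
  then show ?thesis by (simp add: sum.insert_remove sum.remove)
qed

locale loops =
  fixes g :: nat and l m :: "nat \<Rightarrow> real"
  assumes l_pos: "i \<in> {1..g} \<Longrightarrow> 0 < l i" and m_pos: "i \<in> {1..g} \<Longrightarrow> 0 < m i"
begin

abbreviation "\<Gamma> \<equiv> loop_chain g l m"

lemma wf: "wf_metric_graph \<Gamma>"
  by (rule wf_loop_chain) (auto intro: l_pos m_pos)

lemma inner_in_points: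
  assumes "Inner e t \<in> points \<Gamma>"
  shows "1 \<le> edge_index e" "edge_index e \<le> g" "0 < t" "t < len \<Gamma> e"
  using assms by (auto simp: points_def loop_chain_def)

lemma position_le: "p \<in> points \<Gamma> \<Longrightarrow> position p \<le> 2 * g"
  by (auto simp: points_def loop_chain_def)

lemma chips_0 [simp]: "chips 0 D = 0"
  by (simp add: chips_def div_sum_def)

lemma chips_all:
  assumes "D \<in> divisors \<Gamma>"
  shows "chips (2 * g + 1) D = degree D"
  unfolding chips_def degree_eq_div_sum
proof (rule div_sum_cong)
  fix p assume "p \<in> Poly_Mapping.keys D"
  then have "position p \<le> 2 * g" using assms position_le by (auto simp: in_divisors_iff)
  then show "of_bool (position p < 2 * g + 1) = (1::int)" by simp
qed

lemma chips_vertex: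
  assumes "D \<in> divisors \<Gamma>"
  shows "chips (2 * v + 1) D = chips (2 * v) D + Poly_Mapping.lookup D (Vertex v)"
  unfolding chips_def lookup_eq_div_sum div_sum_fun_add[symmetric]
proof (rule div_sum_cong)
  fix p assume "p \<in> Poly_Mapping.keys D"
  then have p: "p \<in> points \<Gamma>" using assms by (auto simp: in_divisors_iff)
  show "of_bool (position p < 2 * v + 1) =
      (of_bool (position p < 2 * v) + of_bool (p = Vertex v) :: int)"
  proof (cases p)
    case (Inner e t)
    then have "1 \<le> edge_index e" using inner_in_points(1)[of e t] p by simp
    then have "2 * edge_index e - 1 < 2 * v + 1 \<longleftrightarrow> 2 * edge_index e - 1 < 2 * v" by presburger
    then show ?thesis by (simp add: Inner)
  qed auto
qed

lemma chips_inner: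
  assumes "D \<in> divisors \<Gamma>" "1 \<le> i"
  shows "chips (2 * i) D = chips (2 * i - 1) D +
    div_sum (on_edge (Seg_L i) (\<lambda>_. 1)) D + div_sum (on_edge (Seg_M i) (\<lambda>_. 1)) D"
  unfolding chips_def div_sum_fun_add[symmetric]
proof (rule div_sum_cong)
  fix p assume "p \<in> Poly_Mapping.keys D"
  then have p: "p \<in> points \<Gamma>" using assms by (auto simp: in_divisors_iff)
  show "of_bool (position p < 2 * i) = (of_bool (position p < 2 * i - 1) +
      on_edge (Seg_L i) (\<lambda>_. 1) p + on_edge (Seg_M i) (\<lambda>_. 1) p :: int)"
  proof (cases p)
    case (Inner e t)
    then show ?thesis using inner_in_points[of e t] p assms(2) by (cases e) auto
  qed (use assms(2) in auto)
qed

lemma edges_into: "{e \<in> edges \<Gamma>. target \<Gamma> e = v} = (if v \<in> {1..g} then {Seg_L v, Seg_M v} else {})"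
  by (auto simp: loop_chain_def)

lemma edges_out_of: "{e \<in> edges \<Gamma>. source \<Gamma> e = v} = (if v < g then {Seg_L (v + 1), Seg_M (v + 1)} else {})"
  by (force simp: loop_chain_def)

text \<open>Conservation of flow: the slopes crossing a cut just after \<open>Q_(i-1)\<close> add up
  to minus the number of chips left of the cut. Behind \<open>Q_g\<close> there is no edge, which
  gives degree zero.\<close>

lemma slopes_iff:
  assumes D: "D \<in> divisors \<Gamma>"
  shows "(\<forall>v\<in>verts \<Gamma>. Poly_Mapping.lookup D (Vertex v) =
       (\<Sum>e\<in>{e \<in> edges \<Gamma>. target \<Gamma> e = v}. \<sigma> e - div_sum (on_edge e (\<lambda>_. 1)) D) -
       (\<Sum>e\<in>{e \<in> edges \<Gamma>. source \<Gamma> e = v}. \<sigma> e)) \<longleftrightarrow>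
    degree D = 0 \<and> (\<forall>i\<in>{1..g}. \<sigma> (Seg_L i) + \<sigma> (Seg_M i) = - chips (2 * i - 1) D)"
    (is "?slopes \<longleftrightarrow> ?degrees")
proof -
  \<comment> \<open>Zero outside \<open>{1..g}\<close>, so that the two end vertices satisfy the
    same equation as the others.\<close>
  define \<tau> where "\<tau> i = (if i \<in> {1..g} then \<sigma> (Seg_L i) + \<sigma> (Seg_M i) else 0)" for i
  define W :: "nat \<Rightarrow> int" where "W i = (if i = 0 then 0 else
    div_sum (on_edge (Seg_L i) (\<lambda>_. 1)) D + div_sum (on_edge (Seg_M i) (\<lambda>_. 1)) D)" for i
  have "?slopes \<longleftrightarrow> (\<forall>v\<le>g. Poly_Mapping.lookup D (Vertex v) = \<tau> v - W v - \<tau> (v + 1))"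
  proof -
    have "(\<Sum>e\<in>{e \<in> edges \<Gamma>. target \<Gamma> e = v}. \<sigma> e - div_sum (on_edge e (\<lambda>_. 1)) D) = \<tau> v - W v"
      if "v \<le> g" for v
      unfolding edges_into using that by (cases v) (simp_all add: \<tau>_def W_def)
    moreover have "(\<Sum>e\<in>{e \<in> edges \<Gamma>. source \<Gamma> e = v}. \<sigma> e) = \<tau> (v + 1)" for v
      unfolding edges_out_of by (simp add: \<tau>_def)
    ultimately show ?thesis by (simp add: loop_chain_def Ball_def)
  qed
  also have "\<dots> \<longleftrightarrow> (\<forall>v\<le>g. \<tau> (v + 1) = - chips (2 * v + 1) D)"
  proof -
    \<comment> \<open>For \<open>v = 0\<close> truncated subtraction turns
      \<open>chips (2 * v - 1)\<close> into \<open>chips 0\<close>, which is zero.\<close>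
    have step: "chips (2 * v + 1) D = chips (2 * v - 1) D + W v + Poly_Mapping.lookup D (Vertex v)" for v
      using chips_vertex[OF D, of v] chips_inner[OF D, of v] by (cases v) (auto simp: W_def)
    show ?thesis
    proof (intro iffI allI impI)
      fix v assume *: "\<forall>v\<le>g. Poly_Mapping.lookup D (Vertex v) = \<tau> v - W v - \<tau> (v + 1)" and "v \<le> g"
      from \<open>v \<le> g\<close> show "\<tau> (v + 1) = - chips (2 * v + 1) D"
      proof (induction v)
        case 0
        then show ?case using * step[of 0] by (simp add: \<tau>_def)
      next
        case (Suc v)
        then show ?case using spec[OF *, of "Suc v"] step[of "Suc v"] by simp
      qed
    next
      fix v assume *: "\<forall>v\<le>g. \<tau> (v + 1) = - chips (2 * v + 1) D" and "v \<le> g"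
      have "\<tau> v = - chips (2 * v - 1) D"
      proof (cases v)
        case (Suc u)
        then show ?thesis using *[rule_format, of u] \<open>v \<le> g\<close> by simp
      qed (simp add: \<tau>_def)
      moreover have "\<tau> (v + 1) = - chips (2 * v + 1) D" using * \<open>v \<le> g\<close> by blast
      ultimately show "Poly_Mapping.lookup D (Vertex v) = \<tau> v - W v - \<tau> (v + 1)"
        using step[of v] by linarith
    qed
  qed
  also have "\<dots> \<longleftrightarrow> degree D = 0 \<and> (\<forall>v<g. \<tau> (v + 1) = - chips (2 * v + 1) D)"
  proof -
    have "\<tau> (g + 1) = - chips (2 * g + 1) D \<longleftrightarrow> degree D = 0"
      using chips_all[OF D] by (simp add: \<tau>_def)
    moreover have "(\<forall>v\<le>g. Q v) \<longleftrightarrow> Q g \<and> (\<forall>v<g. Q v)" for Q :: "nat \<Rightarrow> bool"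
      by (auto simp: order_le_less)
    ultimately show ?thesis by simp
  qed
  also have "\<dots> \<longleftrightarrow> ?degrees"
  proof -
    have "(\<forall>v<g. \<tau> (v + 1) = - chips (2 * v + 1) D) \<longleftrightarrow>
        (\<forall>i\<in>{1..g}. \<tau> i = - chips (2 * i - 1) D)"
    proof (intro iffI ballI allI impI)
      fix i assume *: "\<forall>v<g. \<tau> (v + 1) = - chips (2 * v + 1) D" and i: "i \<in> {1..g}"
      then obtain v where "i = Suc v" by (cases i) auto
      then show "\<tau> i = - chips (2 * i - 1) D" using *[rule_format, of v] i by simp
    next
      fix v assume *: "\<forall>i\<in>{1..g}. \<tau> i = - chips (2 * i - 1) D" "v < g"
      then show "\<tau> (v + 1) = - chips (2 * v + 1) D" using bspec[OF *(1), of "v + 1"] by simp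
    qed
    moreover have "(\<forall>i\<in>{1..g}. \<tau> i = - chips (2 * i - 1) D) \<longleftrightarrow>
        (\<forall>i\<in>{1..g}. \<sigma> (Seg_L i) + \<sigma> (Seg_M i) = - chips (2 * i - 1) D)"
      by (rule ball_cong) (simp_all add: \<tau>_def)
    ultimately show ?thesis by simp
  qed
  finally show ?thesis .
qed

text \<open>The heights along both segments agree at \<open>Q_i\<close> iff the slope on
  \<open>Seg_L i\<close> times \<open>l i + m i\<close> equals the first three terms. Adding the
  coordinate leaves a multiple of the degree and an integer multiple of \<open>l i + m i\<close>;
  this is checked for a single chip by its place relative to the loop.\<close>

lemma coord_height_identity:
  assumes D: "D \<in> divisors \<Gamma>" and i: "i \<in> {1..g}"
  shows "div_sum (on_edge (Seg_L i) (\<lambda>u. l i - u)) D - div_sum (on_edge (Seg_M i) (\<lambda>u. m i - u)) D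
      - m i * of_int (chips (2 * i - 1) D) + div_sum (coord l i) D =
    l i * of_int (degree D) - (l i + m i) *
      of_int (chips (2 * i - 1) D + div_sum (on_edge (Seg_M i) (\<lambda>_. 1)) D)"
  unfolding chips_def degree_eq_div_sum of_int_add of_int_div_sum div_sum_fun_add[symmetric]
    div_sum_fun_diff[symmetric] div_sum_fun_cmul[symmetric]
proof (rule div_sum_cong)
  fix p assume "p \<in> Poly_Mapping.keys D"
  then have p: "p \<in> points \<Gamma>" using D by (auto simp: in_divisors_iff)
  show "on_edge (Seg_L i) (\<lambda>u. l i - u) p - on_edge (Seg_M i) (\<lambda>u. m i - u) p
      - m i * of_int (of_bool (position p < 2 * i - 1)) + coord l i p =
    l i * of_int 1 - (l i + m i) *
      (of_int (of_bool (position p < 2 * i - 1)) + of_int (on_edge (Seg_M i) (\<lambda>_. 1) p))"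
  proof (cases p)
    case (Vertex v)
    then show ?thesis using i by (auto simp: coord_def)
  next
    case (Inner e t)
    have "1 \<le> edge_index e" using inner_in_points(1) p Inner by blast
    then show ?thesis using i Inner
      by (cases e; cases "edge_index e" i rule: linorder_cases) (auto simp: coord_def)
  qed
qed

text \<open>A function can be built loop by loop, the height at \<open>Q_i\<close> being only an
  additive constant for the next loop. On each loop the sum of the two initial slopes is fixed, so
  one integer is free, and the two segments must end at the same height: a congruence.\<close>

theorem principal_iff:
  assumes D: "D \<in> divisors \<Gamma>"
  shows "principal \<Gamma> D \<longleftrightarrow>
    degree D = 0 \<and> (\<forall>i\<in>{1..g}. [div_sum (coord l i) D = 0] (rmod (l i + m i)))"
proof -
  define N where "N i = chips (2 * i - 1) D" for i
  define PL where "PL i = div_sum (on_edge (Seg_L i) (\<lambda>u. l i - u)) D" for i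
  define PM where "PM i = div_sum (on_edge (Seg_M i) (\<lambda>u. m i - u)) D" for i
  have "principal \<Gamma> D \<longleftrightarrow> (\<exists>A (\<sigma> :: chain_edge \<Rightarrow> int).
      (\<forall>e\<in>edges \<Gamma>. A (target \<Gamma> e) = A (source \<Gamma> e) + of_int (\<sigma> e) * len \<Gamma> e -
         div_sum (on_edge e (\<lambda>u. len \<Gamma> e - u)) D) \<and>
      degree D = 0 \<and> (\<forall>i\<in>{1..g}. \<sigma> (Seg_L i) + \<sigma> (Seg_M i) = - N i))"
    unfolding principal_iff_slopes[OF wf D] slopes_iff[OF D] N_def ..
  also have "\<dots> \<longleftrightarrow> degree D = 0 \<and> (\<exists>A (\<sigma> :: chain_edge \<Rightarrow> int). \<forall>i\<in>{1..g}.
      A i = A (i - 1) + of_int (\<sigma> (Seg_L i)) * l i - PL i \<and>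
      A i = A (i - 1) + of_int (\<sigma> (Seg_M i)) * m i - PM i \<and>
      \<sigma> (Seg_L i) + \<sigma> (Seg_M i) = - N i)"
    unfolding loop_chain_def PL_def PM_def by (simp add: ball_Un) blast
  also have "\<dots> \<longleftrightarrow> degree D = 0 \<and> (\<forall>i\<in>{1..g}. \<exists>s::int. of_int s * (l i + m i) = PL i - PM i - m i * of_int (N i))"
  proof (rule conj_cong[OF refl], rule iffI, goal_cases)
    case 1
    then obtain A and \<sigma> :: "chain_edge \<Rightarrow> int" where *: "\<And>i. i \<in> {1..g} \<Longrightarrow>
      A i = A (i - 1) + of_int (\<sigma> (Seg_L i)) * l i - PL i \<and>
      A i = A (i - 1) + of_int (\<sigma> (Seg_M i)) * m i - PM i \<and>
      \<sigma> (Seg_L i) + \<sigma> (Seg_M i) = - N i" by blast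
    show ?case
    proof
      fix i assume i: "i \<in> {1..g}"
      have "\<sigma> (Seg_M i) = - N i - \<sigma> (Seg_L i)" using *[OF i] by simp
      then have "of_int (\<sigma> (Seg_M i)) * m i = (- of_int (N i) - of_int (\<sigma> (Seg_L i))) * m i" by simp
      then show "\<exists>s::int. of_int s * (l i + m i) = PL i - PM i - m i * of_int (N i)"
        using *[OF i] by (intro exI[of _ "\<sigma> (Seg_L i)"]) (auto simp: algebra_simps)
    qed
  next
    case 2
    then obtain s :: "nat \<Rightarrow> int" where s: "\<And>i. i \<in> {1..g} \<Longrightarrow>
        of_int (s i) * (l i + m i) = PL i - PM i - m i * of_int (N i)" by metis
    \<comment> \<open>Heights accumulated along the segments \<open>Seg_L j\<close>; the equation
      for \<open>s\<close> makes the segments \<open>Seg_M j\<close> agree.\<close>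
    define A where "A i = (\<Sum>j=1..i. of_int (s j) * l j - PL j)" for i
    define \<sigma> where "\<sigma> e = (case e of Seg_L i \<Rightarrow> s i | Seg_M i \<Rightarrow> - N i - s i)" for e
    have "A i = A (i - 1) + of_int (\<sigma> (Seg_L i)) * l i - PL i \<and>
      A i = A (i - 1) + of_int (\<sigma> (Seg_M i)) * m i - PM i \<and>
      \<sigma> (Seg_L i) + \<sigma> (Seg_M i) = - N i" if i: "i \<in> {1..g}" for i
    proof -
      have "A i = A (i - 1) + (of_int (s i) * l i - PL i)"
        using i by (cases i) (auto simp: A_def)
      then show ?thesis using s[OF i] by (simp add: \<sigma>_def algebra_simps)
    qed
    then show ?case by blast
  qed
  also have "\<dots> \<longleftrightarrow> degree D = 0 \<and> (\<forall>i\<in>{1..g}. [div_sum (coord l i) D = 0] (rmod (l i + m i)))"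
  proof (rule conj_cong[OF refl], rule ball_cong[OF refl])
    fix i assume deg: "degree D = 0" and i: "i \<in> {1..g}"
    define K where "K = N i + div_sum (on_edge (Seg_M i) (\<lambda>_. 1)) D"
    have eq: "PL i - PM i - m i * of_int (N i) = - div_sum (coord l i) D - (l i + m i) * of_int K"
      using coord_height_identity[OF D i] deg by (simp add: PL_def PM_def N_def K_def)
    show "(\<exists>s::int. of_int s * (l i + m i) = PL i - PM i - m i * of_int (N i)) \<longleftrightarrow>
        [div_sum (coord l i) D = 0] (rmod (l i + m i))"
      unfolding eq rcong_altdef
    proof
      assume "\<exists>s::int. of_int s * (l i + m i) = - div_sum (coord l i) D - (l i + m i) * of_int K"
      then obtain s :: int where "of_int s * (l i + m i) = - div_sum (coord l i) D - (l i + m i) * of_int K" ..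
      then show "\<exists>n. 0 = div_sum (coord l i) D + of_int n * (l i + m i)"
        by (intro exI[of _ "s + K"]) (simp add: algebra_simps)
    next
      assume "\<exists>n. 0 = div_sum (coord l i) D + of_int n * (l i + m i)"
      then obtain n where "0 = div_sum (coord l i) D + of_int n * (l i + m i)" ..
      then show "\<exists>s::int. of_int s * (l i + m i) = - div_sum (coord l i) D - (l i + m i) * of_int K"
        by (intro exI[of _ "n - K"]) (simp add: algebra_simps)
    qed
  qed
  finally show ?thesis .
qed

section \<open>Linear equivalence in coordinates, and points with given coordinate\<close>

lemma div_equiv_iff:
  "(D, E) \<in> div_equiv \<Gamma> \<longleftrightarrow> D \<in> divisors \<Gamma> \<and> E \<in> divisors \<Gamma> \<and> degree D = degree E \<and>
     (\<forall>i\<in>{1..g}. [div_sum (coord l i) D = div_sum (coord l i) E] (rmod (l i + m i)))"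
proof (cases "D \<in> divisors \<Gamma> \<and> E \<in> divisors \<Gamma>")
  case True
  then have "(D, E) \<in> div_equiv \<Gamma> \<longleftrightarrow> principal \<Gamma> (D - E)"
    by (simp add: div_equiv_def principal_def)
  also have "\<dots> \<longleftrightarrow> degree D = degree E \<and>
     (\<forall>i\<in>{1..g}. [div_sum (coord l i) D = div_sum (coord l i) E] (rmod (l i + m i)))"
    using True by (simp add: principal_iff diff_in_divisors degree_eq_div_sum div_sum_diff
      rcong_conv_diff_rmod_eq_0)
  finally show ?thesis using True by blast
qed (auto simp: div_equiv_def)

lemma equiv_div_equiv: "equiv (divisors \<Gamma>) (div_equiv \<Gamma>)"
proof (rule equivI)
  show "div_equiv \<Gamma> \<subseteq> divisors \<Gamma> \<times> divisors \<Gamma>" by (auto simp: div_equiv_def)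
  show "refl_on (divisors \<Gamma>) (div_equiv \<Gamma>)" by (auto simp: refl_on_def div_equiv_iff)
  show "sym (div_equiv \<Gamma>)" by (auto simp: sym_def div_equiv_iff intro: rcong_sym)
  show "trans (div_equiv \<Gamma>)" by (auto simp: trans_def div_equiv_iff intro: rcong_trans)
qed

lemma div_class_eq_iff:
  "D \<in> divisors \<Gamma> \<Longrightarrow> E \<in> divisors \<Gamma> \<Longrightarrow>
    div_class \<Gamma> D = div_class \<Gamma> E \<longleftrightarrow> (D, E) \<in> div_equiv \<Gamma>"
  unfolding div_class_def using eq_equiv_class_iff[OF equiv_div_equiv] by blast

lemma chain_loop_points: "i \<in> {1..g} \<Longrightarrow> chain_loop g l m i \<subseteq> points \<Gamma>"
  by (force simp: chain_loop_def edge_point_def points_def loop_chain_def)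

lemma coord_other_loop:
  assumes "p \<in> chain_loop g l m j" "1 \<le> j" "j \<noteq> i"
  shows "coord l i p = (if j < i then 0 else l i)"
proof -
  have "p = Vertex (j - 1) \<or> p = Vertex j \<or> (\<exists>e t. edge_index e = j \<and> p = Inner e t)"
    using assms(1) by (force simp: chain_loop_def edge_point_def loop_chain_def)
  then show ?thesis using assms(2,3) by (auto simp: coord_def)
qed

text \<open>The representative \<open>y\<close> between \<open>0\<close> and
  \<open>l i + m i\<close> is found on \<open>Seg_L i\<close> if \<open>y \<le> l i\<close>;
  otherwise one goes backwards along \<open>Seg_M i\<close>, where the coordinate is
  \<open>y - (l i + m i)\<close>.\<close>

lemma point_with_coord:
  assumes i: "i \<in> {1..g}"
  obtains p where "p \<in> chain_loop g l m i" "[coord l i p = x] (rmod (l i + m i))"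
proof -
  define y where "y = x rmod (l i + m i)"
  have c: "0 < l i + m i" using l_pos[OF i] m_pos[OF i] by simp
  then have y: "0 \<le> y" "y < l i + m i" by (simp_all add: y_def rmod_nonneg rmod_less)
  have cong: "[y = x] (rmod (l i + m i))" by (simp add: y_def)
  show thesis
  proof (cases "y \<le> l i")
    case True
    let ?p = "edge_point \<Gamma> (Seg_L i) y"
    have "?p \<in> chain_loop g l m i" using True y by (auto simp: chain_loop_def)
    moreover have "coord l i ?p = y"
      using True y i l_pos[OF i] by (auto simp: edge_point_def loop_chain_def coord_def)
    ultimately show ?thesis using that cong by metis
  next
    case False
    let ?p = "edge_point \<Gamma> (Seg_M i) (l i + m i - y)"
    have "?p \<in> chain_loop g l m i" using False y by (auto simp: chain_loop_def)
    moreover have "coord l i ?p = y - (l i + m i)"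
      using False y i l_pos[OF i] by (auto simp: edge_point_def loop_chain_def coord_def)
    moreover have "[y - (l i + m i) = y] (rmod (l i + m i))"
      unfolding rcong_altdef by (intro exI[of _ 1]) simp
    ultimately show ?thesis using that cong by (metis rcong_trans)
  qed
qed

end


section \<open>A chip game and rectangular tableaux\<close>

definition advance :: "(int \<Rightarrow> bool) \<Rightarrow> int \<Rightarrow> int" where
  "advance W u = (if W u then u else u + 1)"

text \<open>
  A counter starts at \<open>0\<close>.  The \<open>i\<close>-th round raises it by one, unless its value is blocked by
  \<open>W i\<close>.  An adversary may moreover raise it by \<open>j\<close> in total, before, between and after the
  rounds; \<open>reach W i j\<close> is the largest value that can be forced by the end of round \<open>i\<close>.
\<close>

fun reach :: "(nat \<Rightarrow> int \<Rightarrow> bool) \<Rightarrow> nat \<Rightarrow> nat \<Rightarrow> int" where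
  "reach W 0 j = int j"
| "reach W (Suc i) 0 = advance (W (Suc i)) (reach W i 0)"
| "reach W (Suc i) (Suc j) = max (advance (W (Suc i)) (reach W i (Suc j))) (reach W (Suc i) j + 1)"

text \<open>A fixed strategy of the adversary; the \<open>b i\<close> raises after round
  \<open>i\<close> model the removal of \<open>b i\<close> chips at \<open>Q_i\<close>.\<close>

fun play :: "(nat \<Rightarrow> int \<Rightarrow> bool) \<Rightarrow> (nat \<Rightarrow> nat) \<Rightarrow> nat \<Rightarrow> int" where
  "play W b 0 = int (b 0)"
| "play W b (Suc i) = advance (W (Suc i)) (play W b i) + int (b (Suc i))"

lemma advance_mono: "u \<le> v \<Longrightarrow> advance W u \<le> advance W v"
  by (cases "u = v") (auto simp: advance_def)

lemma advance_le: "advance W u \<le> u + 1" and advance_ge: "u \<le> advance W u"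
  by (auto simp: advance_def)

lemma reach_Suc_jump: "reach W i j + 1 \<le> reach W i (Suc j)"
  by (cases i) auto

lemma reach_jump: "reach W i j + int q \<le> reach W i (j + q)"
proof (induction q)
  case (Suc q)
  then show ?case using reach_Suc_jump[of W i "j + q"] by simp
qed simp

lemma advance_le_reach: "advance (W (Suc i)) (reach W i j) \<le> reach W (Suc i) j"
  by (cases j) auto

lemma reach_le_reach_Suc: "reach W i j \<le> reach W (Suc i) j"
  using advance_le_reach advance_ge order_trans by blast

lemma reach_Suc_le: "reach W (Suc i) j \<le> reach W i j + 1"
proof (induction j)
  case 0
  then show ?case using advance_le by simp
next
  case (Suc j)
  then show ?case using advance_le reach_Suc_jump[of W i j] by auto
qed

lemma reach_le: "reach W i j \<le> int i + int j"
proof (induction i)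
  case (Suc i)
  then show ?case using reach_Suc_le[of W i j] by simp
qed simp

text \<open>Serves for chips removed in the interior of a loop, where a free raise must be granted
  in addition. If the present value is blocked, the next one is not, so one jump is made before the
  round and the others after it.\<close>

lemma reach_unblocked_jump:
  assumes "\<And>u. \<not> (W (Suc i) u \<and> W (Suc i) (u + 1))" "1 \<le> q"
  shows "reach W i j + int q + 1 \<le> reach W (Suc i) (j + q)"
proof (cases "W (Suc i) (reach W i j)")
  case False
  then have "reach W i j + 1 \<le> reach W (Suc i) j"
    using advance_le_reach[of W i j] by (simp add: advance_def)
  then show ?thesis using reach_jump[of W "Suc i" j q] by simp
next
  case True
  then have "\<not> W (Suc i) (reach W i j + 1)" using assms(1) by blast
  then have "reach W i j + 2 \<le> advance (W (Suc i)) (reach W i (Suc j))"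
    using advance_mono[OF reach_Suc_jump[of W i j], of "W (Suc i)"] by (simp add: advance_def)
  then have "reach W i j + 2 \<le> reach W (Suc i) (Suc j)" by simp
  then show ?thesis using reach_jump[of W "Suc i" "Suc j" "q - 1"] assms(2) by simp
qed

lemma play_cong: "(\<And>v. v \<le> i \<Longrightarrow> b v = b' v) \<Longrightarrow> play W b i = play W b' i"
  by (induction i) auto

text \<open>The strategy is read off from the maximum defining \<open>reach\<close>: where its
  second argument wins, one more raise is made after the last round.\<close>

lemma ex_play_eq_reach: "\<exists>b. (\<Sum>v\<le>i. b v) = j \<and> play W b i = reach W i j"
proof (induction i arbitrary: j)
  case 0
  show ?case by (rule exI[of _ "\<lambda>_. j"]) simp
next
  case (Suc i)
  have pass: "\<exists>b. (\<Sum>v\<le>Suc i. b v) = j \<and> play W b (Suc i) = advance (W (Suc i)) (reach W i j)" for j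
  proof -
    obtain b where b: "(\<Sum>v\<le>i. b v) = j" "play W b i = reach W i j" using Suc by blast
    have "play W (b(Suc i := 0)) i = play W b i" by (rule play_cong) simp
    then show ?thesis using b by (intro exI[of _ "b(Suc i := 0)"]) simp
  qed
  show ?case
  proof (induction j)
    case 0
    then show ?case using pass[of 0] by simp
  next
    case (Suc j)
    show ?case
    proof (cases "reach W (Suc i) (Suc j) = advance (W (Suc i)) (reach W i (Suc j))")
      case True
      then show ?thesis using pass[of "Suc j"] by simp
    next
      case False
      then have eq: "reach W (Suc i) (Suc j) = reach W (Suc i) j + 1"
        by (auto simp: max_def split: if_splits)
      obtain b where b: "(\<Sum>v\<le>Suc i. b v) = j" "play W b (Suc i) = reach W (Suc i) j"
        using Suc by blast
      let ?b = "b(Suc i := b (Suc i) + 1)"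
      have "play W ?b i = play W b i" by (rule play_cong) simp
      then have "play W ?b (Suc i) = reach W (Suc i) (Suc j)" using b(2) eq by simp
      moreover have "(\<Sum>v\<le>Suc i. ?b v) = Suc j" using b(1) by simp
      ultimately show ?thesis by blast
    qed
  qed
qed

text \<open>
  The numbers \<open>height W i j\<close>, \<open>j = 0, 1, \<dots>\<close>, are the column heights of a Young diagram.
  Sparsity of the blocked values makes it gain at most one box per round.
\<close>

definition height :: "(nat \<Rightarrow> int \<Rightarrow> bool) \<Rightarrow> nat \<Rightarrow> nat \<Rightarrow> int" where
  "height W i j = int i + int j - reach W i j"

lemma height_0 [simp]: "height W 0 j = 0"
  by (simp add: height_def)

lemma height_nonneg: "0 \<le> height W i j"
  using reach_le[of W i j] by (simp add: height_def)

lemma height_Suc_le: "height W i (Suc j) \<le> height W i j"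
  using reach_Suc_jump[of W i j] by (simp add: height_def)

lemma height_antimono: "j \<le> j' \<Longrightarrow> height W i j' \<le> height W i j"
  by (rule lift_Suc_antimono_le[of "height W i"]) (auto intro: height_Suc_le)

lemma height_le_Suc: "height W i j \<le> height W (Suc i) j"
  using reach_Suc_le[of W i j] by (simp add: height_def)

lemma height_Suc: "height W (Suc i) j = height W i j + of_bool (reach W (Suc i) j = reach W i j)"
  using reach_Suc_le[of W i j] reach_le_reach_Suc[of W i j] by (auto simp: height_def)

lemma blocked_if_box:
  assumes "reach W (Suc i) j = reach W i j"
  shows "W (Suc i) (reach W i j)"
  using advance_le_reach[of W i j] assms by (auto simp: advance_def split: if_splits)

section \<open>Growth of the diagram under sparse blocking\<close>

context
  fixes W :: "nat \<Rightarrow> int \<Rightarrow> bool" and g :: nat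
  assumes sparse: "\<And>i u v. i \<in> {1..g} \<Longrightarrow> W i u \<Longrightarrow> W i v \<Longrightarrow> \<bar>u - v\<bar> \<le> int g \<Longrightarrow> u = v"
begin

text \<open>For equally high columns the two counters are consecutive values, and if the right one
  stalls, the left one has no room to move either: both values would be blocked.\<close>

lemma box_addable:
  assumes "i < g" "reach W (Suc i) (Suc j) = reach W i (Suc j)"
  shows "height W i (Suc j) < height W i j"
proof (rule ccontr)
  assume "\<not> ?thesis"
  then have eq: "reach W i (Suc j) = reach W i j + 1"
    using reach_Suc_jump[of W i j] by (simp add: height_def)
  then have "reach W (Suc i) j = reach W i j"
    using assms(2) reach_Suc_jump[of W "Suc i" j] reach_le_reach_Suc[of W i j] by simp
  then have "W (Suc i) (reach W i j)" "W (Suc i) (reach W i j + 1)"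
    using blocked_if_box[of W i j] blocked_if_box[OF assms(2)] eq by simp_all
  then have "reach W i j = reach W i j + 1" using assms(1) by (intro sparse[of "Suc i"]) auto
  then show False by simp
qed

text \<open>Two boxes in one round need two blocked values, at distance \<open>j' - j\<close> plus
  the difference of heights. Column \<open>j\<close> and one box in each other column left of
  \<open>j'\<close> are \<open>height W i j + (j' - 1)\<close> boxes, at most \<open>i\<close>; so
  the distance is at most \<open>g\<close> and sparsity applies.\<close>

lemma box_unique_aux:
  assumes "i < g" "j < j'" "j' \<le> r" "(\<Sum>j\<le>r. height W i j) \<le> int i"
    and "reach W (Suc i) j = reach W i j" "reach W (Suc i) j' = reach W i j'"
  shows False
proof -
  obtain j0 where j0: "j' = Suc j0" using assms(2) by (cases j') auto
  have "height W i j' < height W i j0" using box_addable[of i j0] assms j0 by simp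
  then have pos: "1 \<le> height W i x" if "x < j'" for x
    using height_antimono[of x j0 W i] height_nonneg[of W i j'] that j0 by simp
  have "height W i j + int (j' - 1) = height W i j + (\<Sum>x\<in>{..<j'} - {j}. 1)"
    using assms(2) by simp
  also have "\<dots> \<le> height W i j + (\<Sum>x\<in>{..<j'} - {j}. height W i x)"
    using pos by (intro add_left_mono sum_mono) auto
  also have "\<dots> = (\<Sum>x<j'. height W i x)"
    using assms(2) by (simp add: sum.remove)
  also have "\<dots> \<le> (\<Sum>x\<le>r. height W i x)"
    using assms(3) by (intro sum_mono2) (auto intro: height_nonneg)
  finally have "height W i j + int (j' - 1) \<le> int i" using assms(4) by simp
  then have "\<bar>reach W i j' - reach W i j\<bar> \<le> int g"
    using assms(1,2) height_nonneg[of W i j'] height_nonneg[of W i j]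
      height_antimono[of j j' W i] by (simp add: height_def)
  then have "reach W i j' = reach W i j"
    using blocked_if_box assms(1,5,6) by (intro sparse[of "Suc i"]) auto
  then show False
    using reach_jump[of W i j "j' - j"] assms(2) by simp
qed

text \<open>Size bound and uniqueness of the new box support each other: the bound for
  \<open>i\<close> makes the next box unique, and one box per round carries the bound on.\<close>

lemma sum_height_le: "i \<le> g \<Longrightarrow> (\<Sum>j\<le>r. height W i j) \<le> int i"
proof (induction i)
  case (Suc i)
  define J where "J = {j. j \<le> r \<and> reach W (Suc i) j = reach W i j}"
  have "finite J" by (simp add: J_def)
  moreover have "x = y" if "x \<in> J" "y \<in> J" for x y
    using box_unique_aux[of i x y r] box_unique_aux[of i y x r] Suc that
    by (cases x y rule: linorder_cases) (auto simp: J_def)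
  ultimately have "card J \<le> 1" by (metis card_le_Suc0_iff_eq One_nat_def)
  moreover have "(\<Sum>j\<le>r. of_bool (reach W (Suc i) j = reach W i j)) = int (card J)"
    by (simp add: J_def sum.If_cases of_bool_def Int_def atMost_def)
  ultimately show ?case using Suc by (simp add: height_Suc sum.distrib)
qed simp

lemma box_unique:
  assumes "i < g" "reach W (Suc i) j = reach W i j" "reach W (Suc i) j' = reach W i j'"
  shows "j = j'"
proof (rule ccontr)
  assume "j \<noteq> j'"
  then show False
    using box_unique_aux[of i "min j j'" "max j j'" "max j j'"] sum_height_le[of i "max j j'"] assms
    by (auto simp: min_def max_def split: if_splits)
qed

text \<open>Labels each box by the round in which it appears. Cells number the columns from 1,
  heights from 0, hence \<open>b - 1\<close>.\<close>

definition growth_tableau :: "nat \<times> nat \<Rightarrow> nat" where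
  "growth_tableau = (\<lambda>(a, b). LEAST i. int a \<le> height W i (b - 1))"

lemma growth_tableau_le: "int a \<le> height W i (b - 1) \<Longrightarrow> growth_tableau (a, b) \<le> i"
  by (simp add: growth_tableau_def Least_le)

text \<open>A column grows by at most one per round, so in the first round with height at least
  \<open>a\<close> it grew from exactly \<open>a - 1\<close> to \<open>a\<close>, and its counter
  stalled.\<close>

lemma growth_tableau:
  assumes "1 \<le> a" "int a \<le> height W g (b - 1)"
  shows "growth_tableau (a, b) \<in> {1..g}"
    and "height W (growth_tableau (a, b) - 1) (b - 1) = int a - 1"
    and "height W (growth_tableau (a, b)) (b - 1) = int a"
    and "reach W (growth_tableau (a, b)) (b - 1) = reach W (growth_tableau (a, b) - 1) (b - 1)"
proof -
  let ?i = "growth_tableau (a, b)"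
  have i: "int a \<le> height W ?i (b - 1)" "?i \<le> g"
    unfolding growth_tableau_def using assms(2) by (auto intro: LeastI Least_le)
  then have "?i \<noteq> 0" using assms(1) by (intro notI) simp
  then obtain i where i0: "?i = Suc i" by (cases ?i) auto
  have "\<not> int a \<le> height W i (b - 1)"
  proof
    assume "int a \<le> height W i (b - 1)"
    then have "?i \<le> i" by (rule growth_tableau_le)
    then show False using i0 by simp
  qed
  then show "?i \<in> {1..g}" "height W (?i - 1) (b - 1) = int a - 1" "height W ?i (b - 1) = int a"
    "reach W ?i (b - 1) = reach W (?i - 1) (b - 1)"
    using i i0 height_Suc[of W i "b - 1"] by (auto simp: of_bool_def split: if_splits)
qed

text \<open>Column \<open>r\<close> is the lowest one considered, so the final diagram contains the
  rectangle. Labels increase weakly because heights decrease to the right, and strictly because a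
  round adds at most one box.\<close>

theorem filling_of_reach:
  assumes "reach W g r \<le> int g + int r - int h"
  obtains T where "T \<in> fillings (r + 1) h {1..g}"
    "\<And>a b. (a, b) \<in> cells (r + 1) h \<Longrightarrow> W (T (a, b)) (int (T (a, b)) - 1 + int b - int a)"
proof -
  let ?T = "restrict growth_tableau (cells (r + 1) h)"
  note T = growth_tableau
  have full: "1 \<le> a" "1 \<le> b" "int a \<le> height W g (b - 1)" if "(a, b) \<in> cells (r + 1) h" for a b
  proof -
    have "int h \<le> height W g r" using assms by (simp add: height_def)
    also have "\<dots> \<le> height W g (b - 1)" using that by (intro height_antimono) (auto simp: cells_def)
    finally show "int a \<le> height W g (b - 1)" "1 \<le> a" "1 \<le> b" using that by (auto simp: cells_def)
  qed
  have inj: "(a, b) = (a', b')"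
    if "(a, b) \<in> cells (r + 1) h" "(a', b') \<in> cells (r + 1) h"
      "growth_tableau (a, b) = growth_tableau (a', b')" for a b a' b'
  proof -
    note T1 = T[OF full(1,3)[OF that(1)]] and T2 = T[OF full(1,3)[OF that(2)]]
    define i where "i = growth_tableau (a, b) - 1"
    have i: "growth_tableau (a, b) = Suc i" "growth_tableau (a', b') = Suc i" "i < g"
      using T1(1) that(3) by (auto simp: i_def)
    have "b - 1 = b' - 1"
      using T1(4) T2(4) i by (intro box_unique[of i]) auto
    then have "b = b'" using full(2)[OF that(1)] full(2)[OF that(2)] by simp
    moreover have "int a = int a'"
      using T1(3)[unfolded that(3)] T2(3) \<open>b = b'\<close> by (simp only:)
    ultimately show ?thesis by simp
  qed
  have mono: "growth_tableau (a, b) \<le> growth_tableau (a', b')"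
    if "(a, b) \<in> cells (r + 1) h" "(a', b') \<in> cells (r + 1) h" "a \<le> a'" "b \<le> b'" for a b a' b'
  proof -
    have "int a \<le> int a'" using that by simp
    also have "\<dots> = height W (growth_tableau (a', b')) (b' - 1)" using T(3)[OF full(1,3)[OF that(2)]] by simp
    also have "\<dots> \<le> height W (growth_tableau (a', b')) (b - 1)" using that by (intro height_antimono) auto
    finally show ?thesis by (rule growth_tableau_le)
  qed
  have less: "growth_tableau (a, b) < growth_tableau (a', b')"
    if "(a, b) \<in> cells (r + 1) h" "(a', b') \<in> cells (r + 1) h" "a \<le> a'" "b \<le> b'" "(a, b) \<noteq> (a', b')"
    for a b a' b'
    using mono[OF that(1-4)] inj[OF that(1,2)] that(5) by (metis le_neq_implies_less)
  have "?T \<in> fillings (r + 1) h {1..g}"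
    unfolding fillings_def
  proof (intro CollectI conjI allI impI)
    show "?T \<in> cells (r + 1) h \<rightarrow>\<^sub>E {1..g}"
      using T(1) full by (auto simp: PiE_iff)
    show "inj_on ?T (cells (r + 1) h)"
      by (rule inj_onI) (use inj in \<open>auto\<close>)
  qed (use less in auto)
  moreover have "W (?T (a, b)) (int (?T (a, b)) - 1 + int b - int a)"
    if cell: "(a, b) \<in> cells (r + 1) h" for a b
  proof -
    note T1 = T[OF full(1,3)[OF cell]]
    define i where "i = growth_tableau (a, b) - 1"
    have i: "growth_tableau (a, b) = Suc i" using T1(1) by (auto simp: i_def)
    have "W (Suc i) (reach W i (b - 1))"
      using T1(4) i by (intro blocked_if_box[of W i "b - 1"]) simp
    \<comment> \<open>Height \<open>a - 1\<close> in column \<open>b - 1\<close> puts the counter at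
      \<open>i + (b - 1) - (a - 1)\<close>, where \<open>i\<close> is one less than the
      entry.\<close>
    moreover have "reach W i (b - 1) = int i + int b - int a"
      using T1(2) i full(2)[OF cell] by (simp add: height_def)
    ultimately show ?thesis using cell i by simp
  qed
  ultimately show thesis by (rule that)
qed

end

text \<open>By induction on the rounds the diagram contains all cells with entries up to
  \<open>i\<close>. When a cell is due, its neighbours above and to the left are present; if its own
  box is missing, the counter stands exactly at the value that \<open>T\<close> requires to be
  blocked.\<close>

theorem reach_of_filling:
  assumes T: "T \<in> fillings (r + 1) h {1..g}"
    and W: "\<And>a b. (a, b) \<in> cells (r + 1) h \<Longrightarrow> W (T (a, b)) (int (T (a, b)) - 1 + int b - int a)"
  shows "reach W g r \<le> int g + int r - int h"
proof -
  have contained: "int a \<le> height W i (b - 1)" if "(a, b) \<in> cells (r + 1) h" "T (a, b) \<le> i" for a b i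
    using that
  proof (induction i arbitrary: a b)
    case 0
    then show ?case using T by (auto simp: fillings_def PiE_iff)
  next
    case (Suc i)
    show ?case
    proof (cases "T (a, b) \<le> i")
      case True
      then show ?thesis using Suc.IH[of a b] Suc.prems height_le_Suc[of W i "b - 1"] by simp
    next
      case False
      then have Ti: "T (a, b) = Suc i" using Suc.prems by simp
      have cell: "1 \<le> a" "a \<le> h" "1 \<le> b" "b \<le> r + 1" using Suc.prems by (auto simp: cells_def)
      have below: "int a - 1 \<le> height W i (b - 1)"
      proof (cases "a = 1")
        case True
        then show ?thesis using height_nonneg by simp
      next
        case False
        then have c: "(a - 1, b) \<in> cells (r + 1) h" using cell by (auto simp: cells_def)
        have "T (a - 1, b) < T (a, b)" using T c Suc.prems(1) cell(1) by (auto simp: fillings_def)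
        then show ?thesis using Suc.IH[OF c] Ti cell by simp
      qed
      show ?thesis
      proof (cases "int a \<le> height W i (b - 1)")
        case True
        then show ?thesis using height_le_Suc[of W i "b - 1"] by simp
      next
        case False
        then have eq: "reach W i (b - 1) = int i + int b - int a"
          using below cell by (simp add: height_def)
        then have "W (Suc i) (reach W i (b - 1))" using W[OF Suc.prems(1)] Ti by simp
        then have adv: "advance (W (Suc i)) (reach W i (b - 1)) = int i + int b - int a"
          using eq by (simp add: advance_def)
        \<comment> \<open>Without a last jump the counter stalls; with a last jump the bound comes
          from the cell to the left, already in the diagram.\<close>
        have "reach W (Suc i) (b - 1) \<le> int i + int b - int a"
        proof (cases "b = 1")
          case True
          then show ?thesis using adv by simp
        next
          case False
          then obtain j where j: "b = Suc (Suc j)" using cell by (metis One_nat_def not_less_eq_eq old.nat.exhaust zero_le)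
          then have c: "(a, Suc j) \<in> cells (r + 1) h" using cell by (auto simp: cells_def)
          have "T (a, Suc j) < T (a, b)" using T c Suc.prems(1) j by (auto simp: fillings_def)
          then have "int a \<le> height W i j" using Suc.IH[OF c] Ti by simp
          then show ?thesis using adv j reach_Suc_le[of W i j] by (simp add: height_def)
        qed
        then show ?thesis using cell by (simp add: height_def)
      qed
    qed
  qed
  show ?thesis
  proof (cases "h = 0")
    case True
    then show ?thesis using reach_le[of W g r] by simp
  next
    case False
    then have c: "(h, r + 1) \<in> cells (r + 1) h" by (auto simp: cells_def)
    then have "T (h, r + 1) \<le> g" using T by (auto simp: fillings_def PiE_iff)
    then show ?thesis using contained[OF c, of g] by (simp add: height_def)
  qed
qed


section \<open>Ranks of divisors on a chain of loops\<close>

context loops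
begin

definition blocked :: "(nat, chain_edge) divisor \<Rightarrow> nat \<Rightarrow> int \<Rightarrow> bool" where
  "blocked D i u \<longleftrightarrow>
     [div_sum (coord l i) D = of_int (degree D - u) * l i] (rmod (l i + m i))"

lemma blocked_cong:
  assumes "(D, E) \<in> div_equiv \<Gamma>" "i \<in> {1..g}"
  shows "blocked D i u \<longleftrightarrow> blocked E i u"
proof -
  have cong: "[div_sum (coord l i) D = div_sum (coord l i) E] (rmod (l i + m i))"
    and "degree D = degree E"
    using assms by (auto simp: div_equiv_iff)
  then show ?thesis
    unfolding blocked_def using rcong_trans[OF cong] rcong_trans[OF rcong_sym[OF cong]] by auto
qed

section \<open>Counting chips and computing coordinates\<close>

lemma degree_diff: "degree (D - E) = degree D - degree E"
  by (simp add: degree_eq_div_sum div_sum_diff)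

lemma chips_mono: "effective D \<Longrightarrow> a \<le> b \<Longrightarrow> chips a D \<le> chips b D"
  unfolding chips_def by (rule div_sum_mono) auto

lemma chips_le_degree: "effective D \<Longrightarrow> chips a D \<le> degree D"
  unfolding chips_def degree_eq_div_sum by (rule div_sum_mono) auto

lemma chips_gap:
  assumes "effective D" "chips b D \<le> chips a D" "a \<le> b" "p \<in> Poly_Mapping.keys D"
  shows "\<not> (a \<le> position p \<and> position p < b)"
proof -
  let ?\<phi> = "\<lambda>p. of_bool (position p < b) - of_bool (position p < a) :: int"
  have "?\<phi> p = 0"
    using assms
    by (intro div_sum_eq_0_effective[of D ?\<phi>]) (auto simp: chips_def div_sum_fun_diff)
  then show ?thesis by (auto simp: of_bool_def split: if_splits)
qed

lemma coord_sum_gap: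
  assumes "1 \<le> i" "\<And>p. p \<in> Poly_Mapping.keys D \<Longrightarrow> position p \<noteq> 2 * i - 1"
  shows "div_sum (coord l i) D = l i * of_int (degree D - chips (2 * i - 1) D)"
  unfolding chips_def degree_eq_div_sum of_int_div_sum div_sum_fun_diff[symmetric]
    div_sum_fun_cmul[symmetric]
proof (rule div_sum_cong)
  fix p assume "p \<in> Poly_Mapping.keys D"
  then have "position p \<noteq> 2 * i - 1" by (rule assms(2))
  then show "coord l i p = l i * of_int (1 - of_bool (position p < 2 * i - 1))"
    using assms(1) by (auto simp: coord_def)
qed

text \<open>A point on an earlier loop retracts to \<open>Q_(i-1)\<close>, of coordinate
  \<open>0\<close>, a point on a later loop to \<open>Q_i\<close>, of coordinate
  \<open>l i\<close>.\<close>

lemma sum_coord_loops: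
  assumes "S \<subseteq> {1..g}" "i \<in> {1..g}" "\<And>j. j \<in> S \<Longrightarrow> p j \<in> chain_loop g l m j"
  shows "(\<Sum>j\<in>S. of_int (n j) * coord l i (p j)) =
    (if i \<in> S then of_int (n i) * coord l i (p i) else 0) + l i * of_int (\<Sum>j\<in>S \<inter> {i<..}. n j)"
proof -
  have fin: "finite S" using assms(1) finite_subset by blast
  have "(\<Sum>j\<in>S. of_int (n j) * coord l i (p j)) =
      (\<Sum>j\<in>S. (if j = i then of_int (n i) * coord l i (p i) else 0) +
        (if j \<in> {i<..} then l i * of_int (n j) else 0))"
  proof (rule sum.cong)
    fix j assume j: "j \<in> S"
    show "of_int (n j) * coord l i (p j) = (if j = i then of_int (n i) * coord l i (p i) else 0) +
        (if j \<in> {i<..} then l i * of_int (n j) else 0)"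
    proof (cases "j = i")
      case False
      then show ?thesis
        using coord_other_loop[OF assms(3)[OF j], of i] j assms(1) by auto
    qed auto
  qed simp
  also have "\<dots> = (if i \<in> S then of_int (n i) * coord l i (p i) else 0) +
      (\<Sum>j\<in>S \<inter> {i<..}. l i * of_int (n j))"
    using fin by (simp add: sum.distrib sum.inter_restrict)
  finally show ?thesis by (simp add: sum_distrib_left)
qed

text \<open>One point on each loop adjusts the coordinate of that loop, after a correction by
  \<open>l i\<close> for each point on a later loop. Chips at \<open>Vertex 0\<close>, where all
  coordinates vanish, adjust the degree.\<close>

lemma exists_divisor:
  obtains E where "E \<in> divisors \<Gamma>" "degree E = n"
    "\<And>i. i \<in> {1..g} \<Longrightarrow> [div_sum (coord l i) E = x i] (rmod (l i + m i))"
proof -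
  have "\<exists>p. p \<in> chain_loop g l m i \<and>
      [coord l i p = x i - l i * of_int (int (card ({1..g} \<inter> {i<..})))] (rmod (l i + m i))"
    if "i \<in> {1..g}" for i
    using point_with_coord[OF that] by metis
  then obtain p where p: "\<And>i. i \<in> {1..g} \<Longrightarrow> p i \<in> chain_loop g l m i"
    "\<And>i. i \<in> {1..g} \<Longrightarrow>
      [coord l i (p i) = x i - l i * of_int (int (card ({1..g} \<inter> {i<..})))] (rmod (l i + m i))"
    by metis
  define E where "E = (\<Sum>i\<in>{1..g}. frag_of (p i)) + frag_cmul (n - int g) (frag_of (Vertex 0))"
  have "Vertex 0 \<in> points \<Gamma>" by (auto simp: points_def loop_chain_def)
  then have "E \<in> divisors \<Gamma>"
    unfolding E_def using p(1) chain_loop_points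
    by (intro add_in_divisors sum_in_divisors frag_cmul_in_divisors frag_of_in_divisors) blast+
  moreover have "degree E = n"
    by (simp add: E_def degree_eq_div_sum div_sum_add div_sum_sum div_sum_frag_cmul)
  moreover have "[div_sum (coord l i) E = x i] (rmod (l i + m i))" if i: "i \<in> {1..g}" for i
  proof -
    have "coord l i (Vertex 0) = 0" using i by (simp add: coord_def)
    then have "div_sum (coord l i) E = coord l i (p i) + l i * of_int (int (card ({1..g} \<inter> {i<..})))"
      using sum_coord_loops[of "{1..g}" i p "\<lambda>_. 1"] i p(1)
      by (simp add: E_def div_sum_add div_sum_sum div_sum_frag_cmul)
    then show ?thesis
      using rcong_add[OF p(2)[OF i] rcong_refl[of "l i * of_int (int (card ({1..g} \<inter> {i<..})))"]]
      by simp
  qed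
  ultimately show thesis by (rule that)
qed

text \<open>The counter bounds from below the chips of an effective divisor before
  \<open>Q_i\<close>, since a loop without new chips must be blocked. Conversely, a chip is put on
  each loop where the counter rises, at the place dictated by the coordinate, and all others at
  \<open>Q_g\<close>.\<close>

theorem effective_class_iff:
  assumes D: "D \<in> divisors \<Gamma>"
  shows "(\<exists>F\<in>divisors \<Gamma>. effective F \<and> (D, F) \<in> div_equiv \<Gamma>) \<longleftrightarrow> reach (blocked D) g 0 \<le> degree D"
proof
  assume "\<exists>F\<in>divisors \<Gamma>. effective F \<and> (D, F) \<in> div_equiv \<Gamma>"
  then obtain F where F: "F \<in> divisors \<Gamma>" "effective F" "(D, F) \<in> div_equiv \<Gamma>" by blast
  have "reach (blocked D) i 0 \<le> chips (2 * i) F" if "i \<le> g" for i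
    using that
  proof (induction i)
    case (Suc i)
    have mono: "chips (2 * i) F \<le> chips (2 * i + 1) F" "chips (2 * i + 1) F \<le> chips (2 * Suc i) F"
      using F(2) by (auto intro: chips_mono)
    show ?case
    proof (cases "reach (blocked D) i 0 = chips (2 * Suc i) F")
      case False
      then have "reach (blocked D) i 0 + 1 \<le> chips (2 * Suc i) F" using Suc mono by simp
      then show ?thesis using advance_le[of "blocked D (Suc i)" "reach (blocked D) i 0"] by simp
    next
      \<comment> \<open>All counts in between coincide, so \<open>F\<close> has no chip at
        \<open>Q_i\<close> or inside loop \<open>i + 1\<close>.\<close>
      case True
      then have eq: "reach (blocked D) i 0 = chips (2 * i + 1) F" "chips (2 * Suc i) F \<le> chips (2 * i + 1) F"
        using Suc mono by auto
      have "div_sum (coord l (Suc i)) F = l (Suc i) * of_int (degree F - chips (2 * Suc i - 1) F)"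
      proof (rule coord_sum_gap)
        fix p assume "p \<in> Poly_Mapping.keys F"
        from chips_gap[OF F(2) eq(2) _ this] show "position p \<noteq> 2 * Suc i - 1" by auto
      qed simp
      then have "blocked F (Suc i) (reach (blocked D) i 0)"
        by (simp add: blocked_def eq(1) mult.commute)
      then have "blocked D (Suc i) (reach (blocked D) i 0)"
        using blocked_cong[OF F(3), of "Suc i"] Suc.prems by simp
      then show ?thesis using True by (simp add: advance_def)
    qed
  qed simp
  then show "reach (blocked D) g 0 \<le> degree D"
    using chips_le_degree[OF F(2), of "2 * g"] F(3) by (force simp: div_equiv_iff)
next
  assume le: "reach (blocked D) g 0 \<le> degree D"
  define e where "e i = reach (blocked D) i 0" for i
  define \<epsilon> where "\<epsilon> i = (of_bool (\<not> blocked D i (e (i - 1))) :: int)" for i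
  have e_Suc: "e (Suc i) = e i + \<epsilon> (Suc i)" for i
    by (simp add: e_def \<epsilon>_def advance_def)
  have e_sum: "e j - e i = (\<Sum>k\<in>{i<..j}. \<epsilon> k)" if "i \<le> j" for i j
    using that
  proof (induction j)
    case (Suc j)
    show ?case
    proof (cases "i = Suc j")
      case False
      then have "{i<..Suc j} = insert (Suc j) {i<..j}" using Suc.prems by auto
      then show ?thesis using Suc False e_Suc[of j] by simp
    qed simp
  qed simp
  \<comment> \<open>The point takes what remains of the coordinate after the
    \<open>degree D - e i\<close> chips beyond loop \<open>i\<close> have contributed
    \<open>l i\<close> each.\<close>
  have "\<exists>p. p \<in> chain_loop g l m i \<and>
      [coord l i p = div_sum (coord l i) D - l i * of_int (degree D - e i)] (rmod (l i + m i))"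
    if "i \<in> {1..g}" for i
    using point_with_coord[OF that] by metis
  then obtain p where p: "\<And>i. i \<in> {1..g} \<Longrightarrow> p i \<in> chain_loop g l m i"
    "\<And>i. i \<in> {1..g} \<Longrightarrow>
      [coord l i (p i) = div_sum (coord l i) D - l i * of_int (degree D - e i)] (rmod (l i + m i))"
    by metis
  define F where "F = (\<Sum>i\<in>{1..g}. frag_cmul (\<epsilon> i) (frag_of (p i))) +
    frag_cmul (degree D - e g) (frag_of (Vertex g))"
  have "Vertex g \<in> points \<Gamma>" by (auto simp: points_def loop_chain_def)
  then have "F \<in> divisors \<Gamma>"
    unfolding F_def using p(1) chain_loop_points
    by (intro add_in_divisors sum_in_divisors frag_cmul_in_divisors frag_of_in_divisors) blast+
  moreover have "effective F"
    using le unfolding effective_def F_def lookup_add lookup_sum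
    by (auto simp: \<epsilon>_def e_def intro!: add_nonneg_nonneg sum_nonneg)
  moreover have "(D, F) \<in> div_equiv \<Gamma>"
    unfolding div_equiv_iff
  proof (intro conjI ballI)
    have "{0<..g} = {1..g}" by auto
    then have "(\<Sum>i\<in>{1..g}. \<epsilon> i) = e g" using e_sum[of 0 g] by (simp add: e_def)
    then show "degree D = degree F"
      by (simp add: F_def degree_eq_div_sum div_sum_add div_sum_sum div_sum_frag_cmul)
    fix i assume i: "i \<in> {1..g}"
    have "{1..g} \<inter> {i<..} = {i<..g}" using i by auto
    then have "(\<Sum>j\<in>{1..g}. of_int (\<epsilon> j) * coord l i (p j)) =
        of_int (\<epsilon> i) * coord l i (p i) + l i * of_int (e g - e i)"
      using sum_coord_loops[of "{1..g}" i p \<epsilon>] i p(1) e_sum[of i g] by simp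
    moreover have "coord l i (Vertex g) = l i" using i by (simp add: coord_def)
    ultimately have eq: "div_sum (coord l i) F = of_int (\<epsilon> i) * coord l i (p i) + l i * of_int (degree D - e i)"
      by (simp add: F_def div_sum_add div_sum_sum div_sum_frag_cmul algebra_simps)
    show "[div_sum (coord l i) D = div_sum (coord l i) F] (rmod (l i + m i))"
    proof (cases "blocked D i (e (i - 1))")
      case True
      then have "\<epsilon> i = 0" by (simp add: \<epsilon>_def)
      moreover have "e i = e (i - 1)" using e_Suc[of "i - 1"] i \<open>\<epsilon> i = 0\<close> by simp
      ultimately show ?thesis using True by (simp add: eq blocked_def mult.commute)
    next
      case False
      then have "\<epsilon> i = 1" by (simp add: \<epsilon>_def)
      then show ?thesis
        using rcong_add[OF p(2)[OF i] rcong_refl[of "l i * of_int (degree D - e i)"]]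
        by (simp add: eq rcong_sym)
    qed
  qed (use D \<open>F \<in> divisors \<Gamma>\<close> in auto)
  ultimately show "\<exists>F\<in>divisors \<Gamma>. effective F \<and> (D, F) \<in> div_equiv \<Gamma>" by blast
qed

text \<open>Otherwise \<open>l i\<close> would be an integer multiple of
  \<open>l i + m i\<close>.\<close>

lemma not_blocked_twice:
  assumes "i \<in> {1..g}"
  shows "\<not> (blocked D i u \<and> blocked D i (u + 1))"
proof
  assume "blocked D i u \<and> blocked D i (u + 1)"
  then have "[of_int (degree D - u) * l i = of_int (degree D - (u + 1)) * l i] (rmod (l i + m i))"
    unfolding blocked_def using rcong_sym rcong_trans by blast
  then have "(l i) rmod (l i + m i) = 0"
    unfolding rcong_conv_diff_rmod_eq_0 by (simp add: algebra_simps)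
  moreover have "(l i) rmod (l i + m i) = l i"
    using l_pos[OF assms] m_pos[OF assms] by (intro rmod_idem) auto
  ultimately show False using l_pos[OF assms] by simp
qed

text \<open>Chips removed left of the loop lower the degree but not the coordinate; those removed
  right of it lower both in step. Only the former shift the blocked value.\<close>

lemma blocked_diff_iff:
  assumes "1 \<le> i" "\<And>p. p \<in> Poly_Mapping.keys D' \<Longrightarrow> position p \<noteq> 2 * i - 1"
  shows "blocked (D - D') i u \<longleftrightarrow> blocked D i (u + chips (2 * i - 1) D')"
proof -
  have gap: "div_sum (coord l i) D' = l i * of_int (degree D' - chips (2 * i - 1) D')"
    using assms by (rule coord_sum_gap)
  show ?thesis
    unfolding blocked_def rcong_conv_diff_rmod_eq_0 div_sum_diff degree_diff gap
    by (simp add: algebra_simps)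
qed

text \<open>Chips of \<open>D'\<close> at \<open>Q_i\<close> act as jumps after round
  \<open>i\<close>. Chips inside a loop may change its coordinate arbitrarily, but even an unblocked
  round is then covered by \<open>reach_unblocked_jump\<close>.\<close>

lemma reach_diff_le:
  assumes D': "effective D'" and "i \<le> g"
  shows "reach (blocked (D - D')) i 0 + chips (2 * i + 1) D' \<le>
    reach (blocked D) i (nat (chips (2 * i + 1) D'))"
  using \<open>i \<le> g\<close>
proof (induction i)
  case (Suc i)
  let ?W = "blocked D" and ?W' = "blocked (D - D')"
  define B where "B = chips (2 * i + 1) D'"
  define q where "q = chips (2 * Suc i) D' - B"
  define b where "b = chips (2 * Suc i + 1) D' - chips (2 * Suc i) D'"
  have nonneg: "0 \<le> B" "0 \<le> q" "0 \<le> b"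
    using chips_mono[OF D', of 0 "2 * i + 1"] chips_mono[OF D', of "2 * i + 1" "2 * Suc i"]
      chips_mono[OF D', of "2 * Suc i" "2 * Suc i + 1"] by (auto simp: B_def q_def b_def)
  have IH: "reach ?W' i 0 + B \<le> reach ?W i (nat B)" using Suc by (simp add: B_def)
  have "reach ?W' (Suc i) 0 + B + q \<le> reach ?W (Suc i) (nat B + nat q)"
  proof (cases "q = 0")
    case True
    have "?W' (Suc i) (reach ?W' i 0) \<longleftrightarrow> ?W (Suc i) (reach ?W' i 0 + chips (2 * Suc i - 1) D')"
    proof (rule blocked_diff_iff)
      fix p assume "p \<in> Poly_Mapping.keys D'"
      then have "\<not> (2 * i + 1 \<le> position p \<and> position p < 2 * Suc i)"
        using True by (intro chips_gap[OF D']) (auto simp: q_def B_def)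
      then show "position p \<noteq> 2 * Suc i - 1" by auto
    qed simp
    then have "reach ?W' (Suc i) 0 + B = advance (?W (Suc i)) (reach ?W' i 0 + B)"
      by (simp add: advance_def B_def)
    also have "\<dots> \<le> advance (?W (Suc i)) (reach ?W i (nat B))" by (rule advance_mono[OF IH])
    also have "\<dots> \<le> reach ?W (Suc i) (nat B)" by (rule advance_le_reach)
    finally show ?thesis using True by simp
  next
    case False
    then have q: "1 \<le> nat q" "int (nat q) = q" using nonneg by auto
    have "reach ?W i (nat B) + int (nat q) + 1 \<le> reach ?W (Suc i) (nat B + nat q)"
      using q(1) not_blocked_twice[of "Suc i"] Suc.prems by (intro reach_unblocked_jump) auto
    then show ?thesis using IH reach_Suc_le[of ?W' i 0] q(2) by simp
  qed
  also have "\<dots> + int (nat b) \<le> reach ?W (Suc i) (nat B + nat q + nat b)" by (rule reach_jump)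
  finally have "reach ?W' (Suc i) 0 + B + q + b \<le> reach ?W (Suc i) (nat (B + q + b))"
    using nonneg by (simp add: nat_add_distrib)
  then show ?case by (simp add: B_def q_def b_def)
qed (use chips_mono[OF D', of 0 1] in simp)

text \<open>Chips at the marked points are the worst case: \<open>reach_diff_le\<close> bounds every
  \<open>D'\<close>, and an optimal strategy of the adversary, turned into chips at the marked
  points, attains the bound.\<close>

theorem rank_at_least_iff:
  assumes D: "D \<in> divisors \<Gamma>"
  shows "rank_at_least \<Gamma> D r \<longleftrightarrow> reach (blocked D) g r \<le> degree D"
proof
  assume reach: "reach (blocked D) g r \<le> degree D"
  show "rank_at_least \<Gamma> D r"
    unfolding rank_at_least_def
  proof (intro ballI impI)
    fix D' assume D': "D' \<in> divisors \<Gamma>" "effective D' \<and> degree D' = int r"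
    have "reach (blocked (D - D')) g 0 + int r \<le> reach (blocked D) g r"
      using reach_diff_le[of D' g D] D' chips_all[OF D'(1)] by simp
    then have "reach (blocked (D - D')) g 0 \<le> degree (D - D')"
      using reach D' by (simp add: degree_diff)
    then show "\<exists>F\<in>divisors \<Gamma>. effective F \<and> (D - D', F) \<in> div_equiv \<Gamma>"
      using effective_class_iff[OF diff_in_divisors[OF D D'(1)]] by blast
  qed
next
  assume rank: "rank_at_least \<Gamma> D r"
  obtain b where b: "(\<Sum>v\<le>g. b v) = r" "play (blocked D) b g = reach (blocked D) g r"
    using ex_play_eq_reach by blast
  define D' where "D' = (\<Sum>v\<le>g. frag_cmul (int (b v)) (frag_of (Vertex v)) :: (nat, chain_edge) divisor)"
  have D': "D' \<in> divisors \<Gamma>"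
    unfolding D'_def
    by (intro sum_in_divisors frag_cmul_in_divisors frag_of_in_divisors)
      (auto simp: points_def loop_chain_def)
  have "effective D'"
    unfolding D'_def effective_def lookup_sum by (auto intro!: sum_nonneg)
  moreover have deg: "degree D' = int r"
    using b(1) by (simp add: D'_def degree_eq_div_sum div_sum_sum div_sum_frag_cmul flip: of_nat_sum)
  ultimately have "\<exists>F\<in>divisors \<Gamma>. effective F \<and> (D - D', F) \<in> div_equiv \<Gamma>"
    using rank D' by (simp add: rank_at_least_def)
  then have le: "reach (blocked (D - D')) g 0 \<le> degree D - int r"
    using effective_class_iff[OF diff_in_divisors[OF D D']] deg by (simp add: degree_diff)
  have chips: "chips (2 * i + 1) D' = (\<Sum>v\<le>i. int (b v))" if "i \<le> g" for i
  proof -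
    have "chips (2 * i + 1) D' = (\<Sum>v\<le>g. if v \<in> {..i} then int (b v) else 0)"
      unfolding chips_def D'_def div_sum_sum div_sum_frag_cmul by (intro sum.cong) auto
    also have "\<dots> = (\<Sum>v\<in>{..g} \<inter> {..i}. int (b v))" by (rule sum.inter_restrict[symmetric]) simp
    also have "{..g} \<inter> {..i} = {..i}" using that by auto
    finally show ?thesis .
  qed
  \<comment> \<open>No chip of \<open>D'\<close> lies inside a loop, so the counter follows the
    strategy exactly.\<close>
  have "reach (blocked (D - D')) i 0 + chips (2 * i + 1) D' = play (blocked D) b i" if "i \<le> g" for i
    using that
  proof (induction i)
    case 0
    then show ?case using chips[of 0] by simp
  next
    case (Suc i)
    have "blocked (D - D') (Suc i) (reach (blocked (D - D')) i 0) \<longleftrightarrow>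
      blocked D (Suc i) (reach (blocked (D - D')) i 0 + chips (2 * Suc i - 1) D')"
    proof (rule blocked_diff_iff)
      fix p assume "p \<in> Poly_Mapping.keys D'"
      then obtain v where "p = Vertex v"
        unfolding D'_def using keys_sum[of "\<lambda>v. frag_cmul (int (b v)) (frag_of (Vertex v))" "{..g}"]
        by (auto simp: keys_frag_of)
      then show "position p \<noteq> 2 * Suc i - 1" by simp presburger
    qed simp
    then show ?case using Suc chips[of i] chips[of "Suc i"] by (auto simp: advance_def)
  qed
  from this[of g] show "reach (blocked D) g r \<le> degree D"
    using le b(2) chips_all[OF D'] deg by simp
qed

end


section \<open>Counting fillings\<close>

lemma finite_cells [simp]: "finite (cells k h)" and card_cells: "card (cells k h) = k * h"
  by (simp_all add: cells_def)

lemma finite_fillings: "finite A \<Longrightarrow> finite (fillings k h A)"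
  by (rule finite_subset[of _ "cells k h \<rightarrow>\<^sub>E A"]) (auto simp: fillings_def intro: finite_PiE)

lemma
  assumes "T \<in> fillings k h A"
  shows filling_in: "c \<in> cells k h \<Longrightarrow> T c \<in> A"
    and filling_inj: "inj_on T (cells k h)"
    and filling_extensional: "T \<in> extensional (cells k h)"
    and filling_row: "(a, b) \<in> cells k h \<Longrightarrow> (a, b') \<in> cells k h \<Longrightarrow> b < b' \<Longrightarrow> T (a, b) < T (a, b')"
    and filling_column: "(a, b) \<in> cells k h \<Longrightarrow> (a', b) \<in> cells k h \<Longrightarrow> a < a' \<Longrightarrow> T (a, b) < T (a', b)"
  using assms by (auto simp: fillings_def PiE_iff)

lemma card_filling_image: "T \<in> fillings k h A \<Longrightarrow> card (T ` cells k h) = k * h"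
  by (simp add: card_image filling_inj card_cells)

lemma card_fillings_le:
  assumes "strict_mono_on A f" "f ` A \<subseteq> B" "finite B"
  shows "card (fillings k h A) \<le> card (fillings k h B)"
proof (rule card_inj_on_le[where f = "\<lambda>T. restrict (f \<circ> T) (cells k h)"])
  have inj: "inj_on f A" using assms(1) by (rule strict_mono_on_imp_inj_on)
  show "inj_on (\<lambda>T. restrict (f \<circ> T) (cells k h)) (fillings k h A)"
  proof (rule inj_onI)
    fix T T' assume T: "T \<in> fillings k h A" "T' \<in> fillings k h A"
      and eq: "restrict (f \<circ> T) (cells k h) = restrict (f \<circ> T') (cells k h)"
    show "T = T'"
    proof (rule extensionalityI[OF filling_extensional[OF T(1)] filling_extensional[OF T(2)]])
      fix c assume c: "c \<in> cells k h"
      then have "f (T c) = f (T' c)" using fun_cong[OF eq, of c] by simp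
      then show "T c = T' c" using inj filling_in[OF T(1) c] filling_in[OF T(2) c] by (auto dest: inj_onD)
    qed
  qed
  show "(\<lambda>T. restrict (f \<circ> T) (cells k h)) ` fillings k h A \<subseteq> fillings k h B"
  proof (rule image_subsetI)
    fix T assume T: "T \<in> fillings k h A"
    have mono: "f (T c) < f (T c')" if "c \<in> cells k h" "c' \<in> cells k h" "T c < T c'" for c c'
      using assms(1) filling_in[OF T] that by (auto simp: strict_mono_on_def)
    have "inj_on (f \<circ> T) (cells k h)"
      using filling_inj[OF T] inj filling_in[OF T]
      by (intro comp_inj_on) (auto intro: inj_on_subset)
    then have "inj_on (restrict (f \<circ> T) (cells k h)) (cells k h)"
      by (simp cong: inj_on_cong)
    then show "restrict (f \<circ> T) (cells k h) \<in> fillings k h B"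
      using assms(2) filling_in[OF T] mono filling_row[OF T] filling_column[OF T]
      unfolding fillings_def by (auto simp: PiE_iff)
  qed
qed (use assms finite_fillings in auto)

text \<open>Only the order of the entries matters: listing both sets increasingly gives a strictly
  monotone bijection, and the roles can be exchanged.\<close>

lemma card_fillings_cong:
  assumes "finite A" "finite B" "card A = card B"
  shows "card (fillings k h A) = card (fillings k h (B :: nat set))"
proof -
  have le: "card (fillings k h A) \<le> card (fillings k h B)"
    if fin: "finite A" "finite B" and eq: "card A = card B" for A B :: "nat set"
  proof -
    obtain \<alpha> where \<alpha>: "bij_betw \<alpha> {..<card A} A" "strict_mono_on {..<card A} \<alpha>"
      using ex_bij_betw_strict_mono_card[OF fin(1)] .
    obtain \<beta> where \<beta>: "bij_betw \<beta> {..<card A} B" "strict_mono_on {..<card A} \<beta>"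
      using ex_bij_betw_strict_mono_card[OF fin(2)] unfolding eq .
    define f where "f x = \<beta> (the_inv_into {..<card A} \<alpha> x)" for x
    have f_\<alpha>: "f (\<alpha> i) = \<beta> i" if "i < card A" for i
      using that \<alpha>(1) by (simp add: f_def bij_betw_def the_inv_into_f_f)
    have A: "A = \<alpha> ` {..<card A}" using \<alpha>(1) by (simp add: bij_betw_def)
    show ?thesis
    proof (rule card_fillings_le)
      show "strict_mono_on A f"
      proof (rule strict_mono_onI)
        fix x y assume xy: "x \<in> A" "y \<in> A" "x < y"
        then obtain i j where ij: "x = \<alpha> i" "y = \<alpha> j" "i < card A" "j < card A" using A by blast
        have "i < j"
        proof (rule ccontr)
          assume "\<not> i < j"
          then have "\<alpha> j \<le> \<alpha> i"
            using strict_mono_on_leD[OF \<alpha>(2), of j i] ij by simp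
          then show False using xy ij by simp
        qed
        then show "f x < f y" using ij \<beta>(2) by (simp add: f_\<alpha> strict_mono_on_def)
      qed
      show "f ` A \<subseteq> B"
      proof (rule image_subsetI)
        fix x assume "x \<in> A"
        then obtain i where "x = \<alpha> i" "i < card A" using A by blast
        then show "f x \<in> B" using \<beta>(1) f_\<alpha>[of i] by (auto simp: bij_betw_def)
      qed
    qed fact
  qed
  show ?thesis using le[of A B] le[of B A] assms by simp
qed

lemma card_fillings_num_syt:
  assumes "finite A" "card A = k * h"
  shows "card (fillings k h A) = num_syt k h"
  unfolding num_syt_def using assms by (intro card_fillings_cong) auto

text \<open>The fillings are sorted by their set of entries, which has size
  \<open>k * h\<close>.\<close>

lemma card_fillings_upto: "card (fillings k h {1..g}) = (g choose (k * h)) * num_syt k h"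
proof -
  let ?I = "{A. A \<subseteq> {1..g} \<and> card A = k * h}"
  have fin: "finite A" if "A \<in> ?I" for A using that finite_subset by blast
  have image: "T ` cells k h = A" if "T \<in> fillings k h A" "A \<in> ?I" for T A
    using that by (intro card_subset_eq fin) (auto simp: card_filling_image filling_in)
  have "fillings k h {1..g} = (\<Union>A\<in>?I. fillings k h A)"
  proof (intro equalityI subsetI)
    fix T assume T: "T \<in> fillings k h {1..g}"
    then have "T \<in> fillings k h (T ` cells k h)" by (auto simp: fillings_def PiE_iff)
    moreover have "T ` cells k h \<in> ?I" using T filling_in card_filling_image by blast
    ultimately show "T \<in> (\<Union>A\<in>?I. fillings k h A)" by blast
  next
    fix T assume "T \<in> (\<Union>A\<in>?I. fillings k h A)"
    then show "T \<in> fillings k h {1..g}" by (force simp: fillings_def PiE_iff)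
  qed
  also have "card \<dots> = (\<Sum>A\<in>?I. card (fillings k h A))"
  proof (rule card_UN_disjoint)
    show "\<forall>A\<in>?I. \<forall>B\<in>?I. A \<noteq> B \<longrightarrow> fillings k h A \<inter> fillings k h B = {}"
      using image by blast
  qed (use fin finite_fillings in auto)
  also have "\<dots> = (\<Sum>A\<in>?I. num_syt k h)"
    using fin by (intro sum.cong card_fillings_num_syt) auto
  also have "\<dots> = (g choose (k * h)) * num_syt k h"
    using n_subsets[of "{1..g}" "k * h"] by simp
  finally show ?thesis .
qed

lemma filling_less:
  assumes T: "T \<in> fillings k h A" and c: "(a, b) \<in> cells k h" "(a', b') \<in> cells k h"
    and "a < a'" "b < b'"
  shows "T (a, b) < T (a', b')"
proof -
  have "(a, b') \<in> cells k h" using c by (auto simp: cells_def)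
  then show ?thesis
    using filling_row[OF T c(1) _ \<open>b < b'\<close>] filling_column[OF T _ c(2) \<open>a < a'\<close>] by fastforce
qed

text \<open>
  Consider the smallest entry that the two tableaux put into different cells.  These cells lie on
  the same diagonal, and the one closer to the corner would have to hold a smaller entry in one of
  the tableaux, hence the same entry in both.
\<close>

lemma filling_eq_by_contents:
  assumes T: "T \<in> fillings k h A" and T': "T' \<in> fillings k h A"
    and content: "\<And>a' b'. (a', b') \<in> cells k h \<Longrightarrow>
      \<exists>a b. (a, b) \<in> cells k h \<and> T (a, b) = T' (a', b') \<and> int b - int a = int b' - int a'"
  shows "T = T'"
proof -
  have sub: "T' ` cells k h \<subseteq> T ` cells k h"
  proof
    fix x assume "x \<in> T' ` cells k h"
    then obtain a' b' where "(a', b') \<in> cells k h" "x = T' (a', b')" by auto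
    with content[of a' b'] show "x \<in> T ` cells k h" by force
  qed
  have image: "T' ` cells k h = T ` cells k h"
    by (rule card_subset_eq[OF _ sub]) (simp_all add: card_filling_image[OF T] card_filling_image[OF T'])
  have "\<forall>c\<in>cells k h. T' c = n \<longrightarrow> T c = T' c" for n
  proof (induction n rule: less_induct)
    case (less n)
    show ?case
    proof (intro ballI impI)
      fix c assume c: "c \<in> cells k h" "T' c = n"
      obtain a' b' where ab': "c = (a', b')" by (cases c)
      obtain a b where ab: "(a, b) \<in> cells k h" "T (a, b) = n" "int b - int a = int b' - int a'"
        using content[of a' b'] c ab' by auto
      consider "a = a'" "b = b'" | "a < a'" "b < b'" | "a' < a" "b' < b"
        using ab(3) by linarith
      then show "T c = T' c"
      proof cases
        case 1
        then show ?thesis using ab ab' c by simp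
      next
        case 2
        then have "T' (a, b) < n" using filling_less[OF T' ab(1), of a' b'] c ab' by simp
        then have "T (a, b) = T' (a, b)" using less.IH ab(1) by blast
        then show ?thesis using \<open>T' (a, b) < n\<close> ab(2) by simp
      next
        case 3
        then have lt: "T c < n" using filling_less[OF T _ ab(1), of a' b'] c ab ab' by simp
        have "T c \<in> T' ` cells k h" unfolding image using c by simp
        then obtain c'' where c'': "c'' \<in> cells k h" "T' c'' = T c" by auto
        then have "T c'' = T c" using less.IH[of "T c"] lt by simp
        then have "c'' = c" using filling_inj[OF T] c'' c by (auto dest: inj_onD)
        then show ?thesis using c'' by simp
      qed
    qed
  qed
  then show ?thesis
    by (intro extensionalityI[OF filling_extensional[OF T] filling_extensional[OF T']]) blast
qed


section \<open>The Brill-Noether locus\<close>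

locale general_loops = loops +
  assumes generic: "general_chain g l m"
begin

text \<open>A coincidence gives \<open>N * l i = q * (l i + m i)\<close> with
  \<open>0 < N \<le> g\<close>, hence \<open>l i / m i = q / (N - q)\<close> with positive integers
  \<open>q\<close> and \<open>N - q\<close>, which genericity excludes.\<close>

lemma multiples_distinct:
  assumes i: "i \<in> {1..g}" and cong: "[of_int a * l i = of_int b * l i] (rmod (l i + m i))"
    and "\<bar>a - b\<bar> \<le> int g"
  shows "a = b"
proof -
  have no_multiple: False
    if N: "0 < N" "N \<le> int g" and q: "of_int N * l i = of_int q * (l i + m i)" for N q :: int
  proof -
    have lm: "0 < l i" "0 < m i" using l_pos[OF i] m_pos[OF i] by auto
    have "0 < of_int q * (l i + m i)" using N lm by (simp flip: q)
    then have q_pos: "0 < q" using lm by (simp add: zero_less_mult_iff)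
    have eq: "of_int (N - q) * l i = of_int q * m i" using q by (simp add: algebra_simps)
    moreover have "0 < of_int q * m i" using q_pos lm by simp
    ultimately have "0 < of_int (N - q) * l i" by simp
    then have Nq_pos: "0 < N - q" using lm by (simp add: zero_less_mult_iff)
    have "l i / m i = of_int q / of_int (N - q)"
      using eq Nq_pos lm by (simp add: field_simps)
    \<comment> \<open>Both are at most \<open>g - 1\<close>, and \<open>g \<ge> 2\<close> because
      both are positive with sum at most \<open>g\<close>.\<close>
    moreover have "q < 2 * int g - 2" "N - q < 2 * int g - 2" using q_pos Nq_pos N by auto
    ultimately show False
      using generic i q_pos Nq_pos unfolding general_chain_def by blast
  qed
  obtain n where n: "of_int b * l i = of_int a * l i + of_int n * (l i + m i)"
    using cong by (auto simp: rcong_altdef)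
  show "a = b"
  proof (cases a b rule: linorder_cases)
    case less
    then show ?thesis using no_multiple[of "b - a" n] n assms(3) by (simp add: algebra_simps)
  next
    case greater
    then show ?thesis using no_multiple[of "a - b" "- n"] n assms(3) by (simp add: algebra_simps)
  qed
qed

lemma blocked_sparse:
  assumes i: "i \<in> {1..g}" and "blocked D i u" "blocked D i v" "\<bar>u - v\<bar> \<le> int g"
  shows "u = v"
proof -
  have "[of_int (degree D - u) * l i = of_int (degree D - v) * l i] (rmod (l i + m i))"
    using assms(2,3) unfolding blocked_def using rcong_sym rcong_trans by blast
  then have "degree D - u = degree D - v" by (rule multiples_distinct[OF i]) (use assms(4) in simp)
  then show ?thesis by simp
qed

text \<open>
  The value at which the counter must be blocked if the box in row \<open>a\<close> and column \<open>b\<close> is acquired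
  in round \<open>i\<close> comes from \<open>height W (i - 1) (b - 1) = a - 1\<close>.
\<close>

definition obeys :: "nat \<Rightarrow> nat \<Rightarrow> (nat \<times> nat \<Rightarrow> nat) \<Rightarrow> (nat, chain_edge) divisor \<Rightarrow> bool" where
  "obeys k h T D \<longleftrightarrow>
     (\<forall>a b. (a, b) \<in> cells k h \<longrightarrow> blocked D (T (a, b)) (int (T (a, b)) - 1 + int b - int a))"

definition torus :: "int \<Rightarrow> nat \<Rightarrow> nat \<Rightarrow> (nat \<times> nat \<Rightarrow> nat) \<Rightarrow> (nat, chain_edge) divisor set set" where
  "torus d k h T = {div_class \<Gamma> D | D. D \<in> divisors \<Gamma> \<and> degree D = d \<and> obeys k h T D}"

lemma obeys_cong:
  assumes "T \<in> fillings k h {1..g}" "(D, E) \<in> div_equiv \<Gamma>" "obeys k h T D"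
  shows "obeys k h T E"
  unfolding obeys_def
proof (intro allI impI)
  fix a b assume c: "(a, b) \<in> cells k h"
  then have "blocked D (T (a, b)) (int (T (a, b)) - 1 + int b - int a)"
    using assms(3) by (simp add: obeys_def)
  then show "blocked E (T (a, b)) (int (T (a, b)) - 1 + int b - int a)"
    by (simp add: blocked_cong[OF assms(2) filling_in[OF assms(1) c]])
qed

lemma div_class_in_torus_iff:
  assumes "T \<in> fillings k h {1..g}" "D \<in> divisors \<Gamma>"
  shows "div_class \<Gamma> D \<in> torus d k h T \<longleftrightarrow> degree D = d \<and> obeys k h T D"
proof
  assume "div_class \<Gamma> D \<in> torus d k h T"
  then obtain E where E: "E \<in> divisors \<Gamma>" "degree E = d" "obeys k h T E" "div_class \<Gamma> D = div_class \<Gamma> E"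
    by (auto simp: torus_def)
  then have "(E, D) \<in> div_equiv \<Gamma>" using div_class_eq_iff[OF E(1) assms(2)] by simp
  then show "degree D = d \<and> obeys k h T D"
    using obeys_cong[OF assms(1) _ E(3)] E(2) by (auto simp: div_equiv_iff)
qed (use assms(2) in \<open>auto simp: torus_def\<close>)

lemma in_Pic_iff: "C \<in> Pic \<Gamma> d \<longleftrightarrow> (\<exists>D\<in>divisors \<Gamma>. degree D = d \<and> C = div_class \<Gamma> D)"
  by (auto simp: Pic_def quotient_def div_class_def)

text \<open>As \<open>d = g + r - h\<close>, rank at least \<open>r\<close> means that column
  \<open>r\<close> has final height at least \<open>h\<close>, that is, the diagram contains the
  rectangle.\<close>

theorem brill_noether_locus_eq:
  assumes "int h = int g - d + int r"
  shows "brill_noether_locus \<Gamma> d r = (\<Union>T\<in>fillings (r + 1) h {1..g}. torus d (r + 1) h T)"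
proof (intro equalityI subsetI)
  fix C assume "C \<in> brill_noether_locus \<Gamma> d r"
  \<comment> \<open>The representatives of degree \<open>d\<close> and of rank at least
    \<open>r\<close> are a priori different.\<close>
  then obtain D0 D where D0: "D0 \<in> divisors \<Gamma>" "degree D0 = d" "C = div_class \<Gamma> D0"
    and D: "D \<in> divisors \<Gamma>" "C = div_class \<Gamma> D" "rank_at_least \<Gamma> D r"
    unfolding brill_noether_locus_def in_Pic_iff by blast
  then have "(D0, D) \<in> div_equiv \<Gamma>" using div_class_eq_iff[OF D0(1) D(1)] by simp
  then have deg: "degree D = d" using D0 by (simp add: div_equiv_iff)
  then have "reach (blocked D) g r \<le> int g + int r - int h"
    using D rank_at_least_iff assms by simp
  then obtain T where T: "T \<in> fillings (r + 1) h {1..g}"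
    "\<And>a b. (a, b) \<in> cells (r + 1) h \<Longrightarrow> blocked D (T (a, b)) (int (T (a, b)) - 1 + int b - int a)"
    using filling_of_reach[of g "blocked D" r h] blocked_sparse by blast
  then have "obeys (r + 1) h T D" by (simp add: obeys_def)
  then show "C \<in> (\<Union>T\<in>fillings (r + 1) h {1..g}. torus d (r + 1) h T)"
    using T(1) D deg unfolding torus_def by blast
next
  fix C assume "C \<in> (\<Union>T\<in>fillings (r + 1) h {1..g}. torus d (r + 1) h T)"
  then obtain T D where T: "T \<in> fillings (r + 1) h {1..g}"
    and D: "D \<in> divisors \<Gamma>" "degree D = d" "C = div_class \<Gamma> D" "obeys (r + 1) h T D"
    unfolding torus_def by blast
  have "reach (blocked D) g r \<le> int g + int r - int h"
    using reach_of_filling[OF T, of "blocked D"] D(4) by (simp add: obeys_def)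
  then have "rank_at_least \<Gamma> D r" using D assms by (simp add: rank_at_least_iff)
  then show "C \<in> brill_noether_locus \<Gamma> d r"
    using D unfolding brill_noether_locus_def in_Pic_iff by blast
qed

text \<open>Meaningful only if \<open>i\<close> is an entry of \<open>T\<close>.\<close>

definition entry_value :: "nat \<Rightarrow> nat \<Rightarrow> (nat \<times> nat \<Rightarrow> nat) \<Rightarrow> nat \<Rightarrow> int" where
  "entry_value k h T i =
     (case inv_into (cells k h) T i of (a, b) \<Rightarrow> int i - 1 + int b - int a)"

lemma obeys_iff_entry_value:
  assumes "T \<in> fillings k h {1..g}"
  shows "obeys k h T D \<longleftrightarrow> (\<forall>i\<in>T ` cells k h. blocked D i (entry_value k h T i))"
proof -
  have "entry_value k h T (T (a, b)) = int (T (a, b)) - 1 + int b - int a" if "(a, b) \<in> cells k h" for a b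
    using inv_into_f_f[OF filling_inj[OF assms] that] by (simp add: entry_value_def)
  then show ?thesis unfolding obeys_def by (auto simp: image_iff)
qed

text \<open>The tableau prescribes the coordinates indexed by its entries. Each other coordinate is
  free and is swept out by a point moving around its own loop, which leaves the remaining
  coordinates fixed.\<close>

theorem torus_is_loop_product:
  assumes T: "T \<in> fillings k h {1..g}"
  shows "is_loop_product g l m d ({1..g} - T ` cells k h) (torus d k h T)"
proof -
  define S where "S = {1..g} - T ` cells k h"
  define n where "n i = card (S \<inter> {i<..})" for i
  define w where "w = entry_value k h T"
  have S: "S \<subseteq> {1..g}" "finite S" by (auto simp: S_def)
  \<comment> \<open>Deducted in advance are the degree of the moving points and the contribution
    \<open>l i\<close> of each of the \<open>n i\<close> ones on later loops. For
    \<open>i \<in> S\<close> the prescribed value is arbitrary.\<close>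
  obtain E where E: "E \<in> divisors \<Gamma>" "degree E = d - int (card S)"
    "\<And>i. i \<in> {1..g} \<Longrightarrow>
      [div_sum (coord l i) E = of_int (d - w i) * l i - l i * of_nat (n i)] (rmod (l i + m i))"
    by (rule exists_divisor[where n = "d - int (card S)"
        and x = "\<lambda>i. of_int (d - w i) * l i - l i * of_nat (n i)"]) (rule that)
  define F where "F x = E + (\<Sum>i\<in>S. frag_of (x i))" for x :: "nat \<Rightarrow> (nat, chain_edge) gpoint"
  have F_div: "F x \<in> divisors \<Gamma>" if "\<forall>i\<in>S. x i \<in> chain_loop g l m i" for x
    unfolding F_def using that S(1) chain_loop_points E(1)
    by (intro add_in_divisors sum_in_divisors frag_of_in_divisors) blast+
  have F_deg: "degree (F x) = d" for x
    using E(2) by (simp add: F_def degree_eq_div_sum div_sum_add div_sum_sum)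
  have F_coord: "div_sum (coord l i) (F x) =
      div_sum (coord l i) E + (if i \<in> S then coord l i (x i) else 0) + l i * of_nat (n i)"
    if "\<forall>i\<in>S. x i \<in> chain_loop g l m i" "i \<in> {1..g}" for x i
    using sum_coord_loops[of S i x "\<lambda>_. 1"] that S
    by (simp add: F_def div_sum_add div_sum_sum n_def)
  have in_S: "i \<in> S \<longleftrightarrow> i \<notin> T ` cells k h" if "i \<in> {1..g}" for i using that by (simp add: S_def)
  have image: "i \<in> {1..g}" if "i \<in> T ` cells k h" for i using that filling_in[OF T] by blast
  have "torus d k h T = {div_class \<Gamma> (F x) | x. \<forall>i\<in>S. x i \<in> chain_loop g l m i}"
  proof (intro equalityI subsetI)
    fix C assume "C \<in> torus d k h T"
    then obtain D where D: "D \<in> divisors \<Gamma>" "degree D = d" "obeys k h T D" "C = div_class \<Gamma> D"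
      by (auto simp: torus_def)
    have "\<exists>p. p \<in> chain_loop g l m i \<and> [coord l i p = div_sum (coord l i) D -
        (div_sum (coord l i) E + l i * of_nat (n i))] (rmod (l i + m i))" if "i \<in> S" for i
      using point_with_coord[OF subsetD[OF S(1) that]] by metis
    then obtain x where x: "\<forall>i\<in>S. x i \<in> chain_loop g l m i"
      "\<And>i. i \<in> S \<Longrightarrow> [coord l i (x i) = div_sum (coord l i) D -
        (div_sum (coord l i) E + l i * of_nat (n i))] (rmod (l i + m i))"
      by metis
    have "[div_sum (coord l i) D = div_sum (coord l i) (F x)] (rmod (l i + m i))" if i: "i \<in> {1..g}" for i
    proof (cases "i \<in> S")
      case True
      then show ?thesis
        using rcong_add[OF x(2)[OF True] rcong_refl[of "div_sum (coord l i) E + l i * of_nat (n i)"]]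
        by (simp add: F_coord[OF x(1) i] rcong_sym add_ac)
    next
      case False
      then have "blocked D i (w i)"
        using D(3) in_S[OF i] unfolding obeys_iff_entry_value[OF T] w_def by blast
      then have 1: "[div_sum (coord l i) D = of_int (d - w i) * l i] (rmod (l i + m i))"
        unfolding blocked_def D(2) .
      have "[div_sum (coord l i) (F x) = of_int (d - w i) * l i] (rmod (l i + m i))"
        using rcong_add[OF E(3)[OF i] rcong_refl[of "l i * of_nat (n i)"]] False
        by (simp add: F_coord[OF x(1) i])
      with 1 show ?thesis using rcong_sym rcong_trans by blast
    qed
    then have "(D, F x) \<in> div_equiv \<Gamma>"
      using D F_div[OF x(1)] F_deg by (simp add: div_equiv_iff)
    then show "C \<in> {div_class \<Gamma> (F x) | x. \<forall>i\<in>S. x i \<in> chain_loop g l m i}"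
      using x(1) D(1,4) F_div[OF x(1)] div_class_eq_iff by blast
  next
    fix C assume "C \<in> {div_class \<Gamma> (F x) | x. \<forall>i\<in>S. x i \<in> chain_loop g l m i}"
    then obtain x where x: "\<forall>i\<in>S. x i \<in> chain_loop g l m i" "C = div_class \<Gamma> (F x)" by blast
    have "blocked (F x) i (w i)" if "i \<in> T ` cells k h" for i
    proof -
      have i: "i \<in> {1..g}" "i \<notin> S" using image[OF that] in_S that by auto
      show ?thesis
        unfolding blocked_def F_deg
        using rcong_add[OF E(3)[OF i(1)] rcong_refl[of "l i * of_nat (n i)"]] i(2)
        by (simp add: F_coord[OF x(1) i(1)])
    qed
    then have "obeys k h T (F x)" unfolding obeys_iff_entry_value[OF T] w_def by blast
    then show "C \<in> torus d k h T"
      using x F_div F_deg by (auto simp: torus_def)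
  qed
  moreover have "torus d k h T \<subseteq> Pic \<Gamma> d" by (auto simp: torus_def in_Pic_iff)
  ultimately show ?thesis
    unfolding is_loop_product_def S_def[symmetric] F_def using S(1) E(1) by blast
qed

text \<open>Column minus row takes at most \<open>k + h - 1 \<le> k * h\<close> values, so two of
  them are close enough for \<open>blocked_sparse\<close>.\<close>

lemma content_diff_le:
  assumes "(a, b) \<in> cells k h" "(a', b') \<in> cells k h" "k * h \<le> g"
  shows "\<bar>(int b - int a) - (int b' - int a')\<bar> \<le> int g"
proof -
  have "1 \<le> a" "a \<le> h" "1 \<le> b" "b \<le> k" "1 \<le> a'" "a' \<le> h" "1 \<le> b'" "b' \<le> k"
    using assms by (auto simp: cells_def)
  moreover have "int k + int h - 1 \<le> int k * int h"
  proof -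
    have "0 \<le> (int k - 1) * (int h - 1)" using calculation by simp
    then show ?thesis by (simp add: algebra_simps)
  qed
  moreover have "int k * int h \<le> int g" using assms(3) by (simp flip: of_nat_mult)
  ultimately show ?thesis by linarith
qed

lemma filling_size: "T \<in> fillings k h {1..g} \<Longrightarrow> k * h \<le> g"
  using card_mono[of "{1..g}" "T ` cells k h"] card_filling_image filling_in by fastforce

text \<open>A well-chosen class in the torus of \<open>T\<close> also lies in that of
  \<open>T'\<close>. This forces each entry of \<open>T'\<close> to be an entry of \<open>T\<close>
  on the same diagonal, and \<open>filling_eq_by_contents\<close> applies.\<close>

theorem torus_inj: "inj_on (torus d k h) (fillings k h {1..g})"
proof (rule inj_onI)
  fix T T' assume T: "T \<in> fillings k h {1..g}" and T': "T' \<in> fillings k h {1..g}"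
    and eq: "torus d k h T = torus d k h T'"
  let ?w = "entry_value k h T" and ?w' = "entry_value k h T'"
  \<comment> \<open>On loops that are not entries of \<open>T\<close> the coordinate is half a turn
    away from what \<open>T'\<close> would require there.\<close>
  define x where "x i = (if i \<in> T ` cells k h then of_int (d - ?w i) * l i
    else of_int (d - ?w' i) * l i + (l i + m i) / 2)" for i
  obtain D where D: "D \<in> divisors \<Gamma>" "degree D = d"
    "\<And>i. i \<in> {1..g} \<Longrightarrow> [div_sum (coord l i) D = x i] (rmod (l i + m i))"
    by (rule exists_divisor[where n = d and x = x]) (rule that)
  have image: "i \<in> {1..g}" if "i \<in> T ` cells k h \<or> i \<in> T' ` cells k h" for i
    using that filling_in[OF T] filling_in[OF T'] by blast
  have "blocked D i (?w i)" if "i \<in> T ` cells k h" for i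
    using D(3)[of i] image[of i] that by (simp add: blocked_def D(2) x_def)
  then have obT: "obeys k h T D" using obeys_iff_entry_value[OF T] by blast
  then have obT': "obeys k h T' D"
    using div_class_in_torus_iff[OF T D(1)] div_class_in_torus_iff[OF T' D(1)] eq D(2) by blast
  have sub: "i \<in> T ` cells k h" if "i \<in> T' ` cells k h" for i
  proof (rule ccontr)
    assume i: "i \<notin> T ` cells k h"
    have i': "i \<in> {1..g}" using that image by blast
    have "blocked D i (?w' i)" using obT' that obeys_iff_entry_value[OF T'] by blast
    then have "[of_int (d - ?w' i) * l i = x i] (rmod (l i + m i))"
      using D(3)[OF i'] unfolding blocked_def D(2) using rcong_sym rcong_trans by blast
    then obtain n where "(l i + m i) / 2 = of_int n * (l i + m i)"
      using i by (auto simp: rcong_altdef x_def)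
    then have half: "of_int n * (l i + m i) = (l i + m i) / 2" by (rule sym)
    have "(l i + m i) * (of_int (2 * n) - 1) = 2 * (of_int n * (l i + m i)) - (l i + m i)"
      by (simp add: algebra_simps)
    also have "\<dots> = 0" unfolding half by simp
    finally have "(l i + m i) * (of_int (2 * n) - 1) = 0" .
    then have "of_int (2 * n) = (1 :: real)" using l_pos[OF i'] m_pos[OF i'] by auto
    then have "2 * n = 1" by (simp only: of_int_eq_1_iff)
    then show False by presburger
  qed
  show "T = T'"
  proof (rule filling_eq_by_contents[OF T T'])
    fix a' b' assume c': "(a', b') \<in> cells k h"
    then obtain a b where c: "(a, b) \<in> cells k h" "T (a, b) = T' (a', b')"
      using sub[of "T' (a', b')"] by (metis imageE imageI surj_pair)
    let ?i = "T (a, b)"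
    have "int ?i - 1 + int b - int a = int ?i - 1 + int b' - int a'"
    proof (rule blocked_sparse)
      show "?i \<in> {1..g}" using filling_in[OF T c(1)] .
      show "blocked D ?i (int ?i - 1 + int b - int a)" using obT c(1) by (auto simp: obeys_def)
      show "blocked D ?i (int ?i - 1 + int b' - int a')" using obT' c' c(2) by (auto simp: obeys_def)
      show "\<bar>(int ?i - 1 + int b - int a) - (int ?i - 1 + int b' - int a')\<bar> \<le> int g"
        using content_diff_le[OF c(1) c' filling_size[OF T]] by linarith
    qed
    then show "\<exists>a b. (a, b) \<in> cells k h \<and> T (a, b) = T' (a', b') \<and> int b - int a = int b' - int a'"
      using c by (intro exI[of _ a] exI[of _ b]) auto
  qed
qed

end

theorem theorem2p8:
  fixes g r k :: nat and d kbar \<rho> :: int and l m :: "nat \<Rightarrow> real"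
  assumes "general_chain g l m"
    and "k = r + 1"
    and "kbar = int g - d + int r"
    and "0 \<le> kbar"
    and "\<rho> = int g - int k * kbar"
  shows "\<exists>P.
      (\<forall>T\<in>fillings k (nat kbar) {1..g}.
         int (card ({1..g} - T ` cells k (nat kbar))) = \<rho> \<and>
         is_loop_product g l m d ({1..g} - T ` cells k (nat kbar)) (P T)) \<and>
      inj_on P (fillings k (nat kbar) {1..g}) \<and>
      card (P ` fillings k (nat kbar) {1..g}) = int_binomial g \<rho> * num_syt k (nat kbar) \<and>
      (\<forall>A. A \<subseteq> {1..g} \<and> int (card A) = int g - \<rho> \<longrightarrow>
         card (fillings k (nat kbar) A) = num_syt k (nat kbar)) \<and>
      brill_noether_locus (loop_chain g l m) d r = (\<Union>T\<in>fillings k (nat kbar) {1..g}. P T)"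
proof -
  interpret general_loops g l m
    using assms(1) by unfold_locales (auto simp: general_chain_def)
  define h where "h = nat kbar"
  have h: "int h = kbar" using assms(4) by (simp add: h_def)
  have \<rho>: "\<rho> = int g - int (k * h)" using assms(5) h by simp
  show ?thesis
    unfolding h_def[symmetric]
  proof (intro exI[of _ "torus d k h"] conjI ballI allI impI)
    fix T assume T: "T \<in> fillings k h {1..g}"
    then have "T ` cells k h \<subseteq> {1..g}" using filling_in[OF T] by blast
    then have "card ({1..g} - T ` cells k h) = g - k * h"
      using card_filling_image[OF T] by (simp add: card_Diff_subset)
    then show "int (card ({1..g} - T ` cells k h)) = \<rho>"
      using filling_size[OF T] \<rho> by (simp add: of_nat_diff)
    show "is_loop_product g l m d ({1..g} - T ` cells k h) (torus d k h T)"
      using T by (rule torus_is_loop_product)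
  next
    show "inj_on (torus d k h) (fillings k h {1..g})" by (rule torus_inj)
    then have "card (torus d k h ` fillings k h {1..g}) = (g choose (k * h)) * num_syt k h"
      by (simp only: card_image card_fillings_upto)
    \<comment> \<open>By symmetry of binomial coefficients; for \<open>k * h > g\<close> both sides
      are zero.\<close>
    also have "g choose (k * h) = int_binomial g \<rho>"
    proof (cases "k * h \<le> g")
      case True
      then have "\<rho> = int (g - k * h)" using \<rho> by (simp only: of_nat_diff)
      then show ?thesis using binomial_symmetric[OF True] by (simp add: int_binomial_def)
    next
      case False
      then have "\<rho> < 0" using \<rho> by linarith
      then show ?thesis using False by (simp add: int_binomial_def binomial_eq_0)
    qed
    finally show "card (torus d k h ` fillings k h {1..g}) = int_binomial g \<rho> * num_syt k h" .
  next
    fix A assume A: "A \<subseteq> {1..g} \<and> int (card A) = int g - \<rho>"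
    then have "int (card A) = int (k * h)" using \<rho> by simp
    then have "card A = k * h" by (simp only: of_nat_eq_iff)
    moreover have "finite A" using A finite_subset by blast
    ultimately show "card (fillings k h A) = num_syt k h" by (intro card_fillings_num_syt)
  next
    show "brill_noether_locus \<Gamma> d r = (\<Union>T\<in>fillings k h {1..g}. torus d k h T)"
      unfolding assms(2) by (rule brill_noether_locus_eq) (use h assms(3) in simp)
  qed
qed

end
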